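(* Let $X$ be a separable symmetric sequence space and let $1\le p\le\infty$. The following conditions are equivalent: (a) $\ell^p$ is symmetrically block finitely represented in the unit vector basis $\{e_k\}_{k=1}^\infty$ of $X$; (b) $\ell^p$ is symmetrically finitely represented in $X$; (c) $\ell^p$ is crudely symmetrically finitely represented in $X$; (d) $2^{1/p}$ (with $2^{1/\infty}:=1$) is an approximate eigenvalue of the operator $D:X\to X$.
   Context: A Banach sequence lattice is a Banach space $E$ of real sequences such that if $x\in E$ and $|y_k|\le|x_k|$ for all $k$, then $y\in E$ and $\|y\|_E\le\|x\|_E$. For a bounded real sequence $u=(u_k)$, $u^*=(u^*_k)$ denotes the nonincreasing rearrangement of $(|u_k|)$, $u^*_k=\inf_{\mathrm{card}A=k-1}\sup_{i\in\mathbb N\setminus A}|u_i|$. A symmetric sequence space is a Banach sequence lattice $X\subset\ell^\infty$ such that $x\in X$ and $y^*=x^*$ imply $y\in X$ and $\|y\|_X=\|x\|_X$. $e_k$ denotes the $k$-th unit vector. For $x=(x_n)$ let $\sigma_2x=(x_{[(1+n)/2]})_{n\ge1}$ and $\tau_1x=(x_{n-1})_{n\ge1}$ (with $x_0:=0$); $D:=\tau_1\sigma_2$, i.e. $(Dx)_k=x_{[k/2]}$, so $Dx=(0,x_1,x_1,x_2,x_2,\dots)$. A real number $\lambda$ is an approximate eigenvalue of a bounded operator $T$ on $X$ if there are $u_n\in X$ with $\|u_n\|_X=1$ and $\|Tu_n-\lambda u_n\|_X\to0$. For $a\in\mathbb R^n$, $\|a\|_p=(\sum|a_k|^p)^{1/p}$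 if $p<\infty$ and $\|a\|_\infty=\max|a_k|$. Two sequences $x,y$ have the same ordered distribution if there is a permutation $\pi$ of $\mathbb N$ with $y_{\pi(k)}=x_k$ for all $k$. Two finite blocks $u=\sum_{i=1}^m\alpha_ie_{n_i}$, $v=\sum_{i=1}^m\beta_ie_{k_i}$ ($n_1<\dots<n_m$, $k_1<\dots<k_m$) have the same ordered distribution if $\beta_i=\alpha_{\pi(i)}$ for some permutation $\pi$ of $\{1,\dots,m\}$. $\ell^p$ is symmetrically block finitely represented in $\{e_k\}$ if for every $n\in\mathbb N$ and $\varepsilon>0$ there are $0=m_0<m_1<\dots<m_n$ and reals $\alpha_i$ such that the blocks $u_k=\sum_{i=m_{k-1}+1}^{m_k}\alpha_ie_i$, $k=1,\dots,n$, pairwise have the same ordered distribution and $(1+\varepsilon)^{-1}\|a\|_p\le\|\sum_{k=1}^na_ku_k\|_X\le(1+\varepsilon)\|a\|_p$ for all $a\in\mathbb R^n$. $\ell^p$ is symmetrically finitely represented in $X$ if for every $n\in\mathbb N$ and $\varepsilon>0$ there exist pairwise disjointly supported $x_1,\dots,x_n\in X$, pairwise having the same ordered distribution, with $(1+\varepsilon)^{-1}\|a\|_p\le\|\sum_{k=1}^na_kx_k\|_X\le(1+\varepsilon)\|a\|_p$ for all $a\in\mathbb R^n$. $\ell^p$ is crudely symmetrically finitely represented in $X$ if there is $C>0$ such that for every $n$ there exist such $x_1,\dots,x_n$ with $C^{-1}\|a\|_p\le\|\sum a_kx_k\|_X\le C\|a\|_p$ for all $a\in\mathbb R^n$. *)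

theory Defs
  imports "HOL-Analysis.Analysis" "HOL-Library.Extended_Real"
begin

text \<open>Sequences are indexed from 0: the function x :: nat => real represents the
  paper's sequence (x_1, x_2, ...) via x_(k+1) = x k.\<close>

definition banach_seq_lattice :: "(nat \<Rightarrow> real) set \<Rightarrow> ((nat \<Rightarrow> real) \<Rightarrow> real) \<Rightarrow> bool" where
  "banach_seq_lattice X N \<longleftrightarrow>
     \<comment> \<open>linear subspace of real sequences\<close>
     (\<lambda>k. 0) \<in> X \<and> (\<forall>x\<in>X. \<forall>y\<in>X. (\<lambda>k. x k + y k) \<in> X) \<and> (\<forall>c::real. \<forall>x\<in>X. (\<lambda>k. c * x k) \<in> X) \<and>
     \<comment> \<open>N is a norm on X\<close>
     (\<forall>x\<in>X. N x \<ge> 0) \<and> (\<forall>x\<in>X. N x = 0 \<longleftrightarrow> x = (\<lambda>k. 0)) \<and>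
     (\<forall>c::real. \<forall>x\<in>X. N (\<lambda>k. c * x k) = \<bar>c\<bar> * N x) \<and>
     (\<forall>x\<in>X. \<forall>y\<in>X. N (\<lambda>k. x k + y k) \<le> N x + N y) \<and>
     \<comment> \<open>completeness\<close>
     (\<forall>f::nat \<Rightarrow> nat \<Rightarrow> real. (\<forall>n. f n \<in> X) \<and>
          (\<forall>e>0. \<exists>M. \<forall>m\<ge>M. \<forall>n\<ge>M. N (\<lambda>k. f m k - f n k) < e)
        \<longrightarrow> (\<exists>x\<in>X. (\<lambda>n. N (\<lambda>k. f n k - x k)) \<longlonglongrightarrow> 0)) \<and>
     \<comment> \<open>lattice (ideal) property\<close>
     (\<forall>x\<in>X. \<forall>y. (\<forall>k. \<bar>y k\<bar> \<le> \<bar>x k\<bar>) \<longrightarrow> y \<in> X \<and> N y \<le> N x)"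

text \<open>Nonincreasing rearrangement; rearr u k is the paper's u^*_(k+1), i.e. the
  infimum over all sets A of cardinality k of the supremum of |u_i| over i not in A.\<close>
definition rearr :: "(nat \<Rightarrow> real) \<Rightarrow> nat \<Rightarrow> real" where
  "rearr u k = Inf ((\<lambda>A. Sup ((\<lambda>i. \<bar>u i\<bar>) ` (UNIV - A))) ` {A. finite A \<and> card A = k})"

definition symmetric_seq_space :: "(nat \<Rightarrow> real) set \<Rightarrow> ((nat \<Rightarrow> real) \<Rightarrow> real) \<Rightarrow> bool" where
  "symmetric_seq_space X N \<longleftrightarrow> banach_seq_lattice X N \<and>
     (\<forall>x\<in>X. bdd_above (range (\<lambda>k. \<bar>x k\<bar>))) \<and>
     (\<forall>x\<in>X. \<forall>y. bdd_above (range (\<lambda>k. \<bar>y k\<bar>)) \<and> rearr y = rearr x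
        \<longrightarrow> y \<in> X \<and> N y = N x)"

definition separable_seq_space :: "(nat \<Rightarrow> real) set \<Rightarrow> ((nat \<Rightarrow> real) \<Rightarrow> real) \<Rightarrow> bool" where
  "separable_seq_space X N \<longleftrightarrow> (\<exists>S. countable S \<and> S \<subseteq> X \<and>
     (\<forall>x\<in>X. \<forall>e>0. \<exists>s\<in>S. N (\<lambda>k. x k - s k) < e))"

text \<open>The operator D = tau_1 sigma_2, (Dx)_k = x_[k/2] (x_0 = 0), in 0-indexed form.\<close>
definition Dop :: "(nat \<Rightarrow> real) \<Rightarrow> nat \<Rightarrow> real" where
  "Dop x j = (if j = 0 then 0 else x ((j + 1) div 2 - 1))"

definition pnorm :: "ereal \<Rightarrow> nat \<Rightarrow> (nat \<Rightarrow> real) \<Rightarrow> real" where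
  "pnorm p n a = (if p = \<infinity> then Max ((\<lambda>k. \<bar>a k\<bar>) ` {..<n})
                  else (\<Sum>k<n. \<bar>a k\<bar> powr real_of_ereal p) powr (1 / real_of_ereal p))"

definition two_pow_inv :: "ereal \<Rightarrow> real" where
  "two_pow_inv p = (if p = \<infinity> then 1 else 2 powr (1 / real_of_ereal p))"

definition same_ord_dist :: "(nat \<Rightarrow> real) \<Rightarrow> (nat \<Rightarrow> real) \<Rightarrow> bool" where
  "same_ord_dist x y \<longleftrightarrow> (\<exists>\<pi>. bij \<pi> \<and> (\<forall>k. y (\<pi> k) = x k))"

definition disjointly_supported :: "nat \<Rightarrow> (nat \<Rightarrow> nat \<Rightarrow> real) \<Rightarrow> bool" where
  "disjointly_supported n x \<longleftrightarrow>
     (\<forall>j<n. \<forall>k<n. j \<noteq> k \<longrightarrow> (\<forall>i. x j i = 0 \<or> x k i = 0))"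

definition lincomb :: "nat \<Rightarrow> (nat \<Rightarrow> real) \<Rightarrow> (nat \<Rightarrow> nat \<Rightarrow> real) \<Rightarrow> nat \<Rightarrow> real" where
  "lincomb n a x = (\<lambda>i. \<Sum>k<n. a k * x k i)"

text \<open>Block of coefficients alpha on the index interval [lo, hi) (paper: indices lo+1..hi).\<close>
definition block :: "(nat \<Rightarrow> real) \<Rightarrow> nat \<Rightarrow> nat \<Rightarrow> nat \<Rightarrow> real" where
  "block \<alpha> lo hi = (\<lambda>i. if lo \<le> i \<and> i < hi then \<alpha> i else 0)"

definition sym_block_fin_rep :: "ereal \<Rightarrow> (nat \<Rightarrow> real) set \<Rightarrow> ((nat \<Rightarrow> real) \<Rightarrow> real) \<Rightarrow> bool" where
  "sym_block_fin_rep p X N \<longleftrightarrow>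
     (\<forall>n\<ge>1. \<forall>\<epsilon>>0. \<exists>m::nat \<Rightarrow> nat. \<exists>\<alpha>::nat \<Rightarrow> real.
        m 0 = 0 \<and> (\<forall>k<n. m k < m (Suc k)) \<and>
        (let u = (\<lambda>k. block \<alpha> (m k) (m (Suc k))) in
          (\<forall>k<n. u k \<in> X) \<and>
          (\<forall>j<n. \<forall>k<n. same_ord_dist (u j) (u k)) \<and>
          (\<forall>a. pnorm p n a / (1 + \<epsilon>) \<le> N (lincomb n a u) \<and>
               N (lincomb n a u) \<le> (1 + \<epsilon>) * pnorm p n a)))"

definition sym_fin_rep :: "ereal \<Rightarrow> (nat \<Rightarrow> real) set \<Rightarrow> ((nat \<Rightarrow> real) \<Rightarrow> real) \<Rightarrow> bool" where
  "sym_fin_rep p X N \<longleftrightarrow>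
     (\<forall>n\<ge>1. \<forall>\<epsilon>>0. \<exists>x::nat \<Rightarrow> nat \<Rightarrow> real.
        (\<forall>k<n. x k \<in> X) \<and> disjointly_supported n x \<and>
        (\<forall>j<n. \<forall>k<n. same_ord_dist (x j) (x k)) \<and>
        (\<forall>a. pnorm p n a / (1 + \<epsilon>) \<le> N (lincomb n a x) \<and>
             N (lincomb n a x) \<le> (1 + \<epsilon>) * pnorm p n a))"

definition crude_sym_fin_rep :: "ereal \<Rightarrow> (nat \<Rightarrow> real) set \<Rightarrow> ((nat \<Rightarrow> real) \<Rightarrow> real) \<Rightarrow> bool" where
  "crude_sym_fin_rep p X N \<longleftrightarrow>
     (\<exists>C>0. \<forall>n\<ge>1. \<exists>x::nat \<Rightarrow> nat \<Rightarrow> real.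
        (\<forall>k<n. x k \<in> X) \<and> disjointly_supported n x \<and>
        (\<forall>j<n. \<forall>k<n. same_ord_dist (x j) (x k)) \<and>
        (\<forall>a. pnorm p n a / C \<le> N (lincomb n a x) \<and>
             N (lincomb n a x) \<le> C * pnorm p n a))"

definition approx_eigenvalue ::
  "((nat \<Rightarrow> real) \<Rightarrow> nat \<Rightarrow> real) \<Rightarrow> real \<Rightarrow> (nat \<Rightarrow> real) set \<Rightarrow> ((nat \<Rightarrow> real) \<Rightarrow> real) \<Rightarrow> bool" where
  "approx_eigenvalue T lam X N \<longleftrightarrow>
     (\<exists>u::nat \<Rightarrow> nat \<Rightarrow> real. (\<forall>n. u n \<in> X \<and> N (u n) = 1) \<and>
        (\<lambda>n. N (\<lambda>k. T (u n) k - lam * u n k)) \<longlonglongrightarrow> 0)"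

end

theory Submission
  imports Defs "HOL-Library.Discrete_Functions"
begin

text \<open>
  Write \<open>a \<otimes> x\<close> for a sum of disjoint copies of \<open>x\<close> with weights \<open>a\<^sub>k\<close>. A symmetric norm does not see
  where the copies sit, so crude representability of \<open>\<ell>\<^sup>p\<close> says that the norm of \<open>a \<otimes> x\<close> is comparable
  to the \<open>\<ell>\<^sup>p\<close>-norm of \<open>a\<close>, with a constant \<open>C\<close>. Separability gives order continuity, which allows
  \<open>x\<close> to be taken finitely supported.

  From (c) to (d): \<open>D\<close> sends each node of the binary tree \<open>k \<mapsto> 2k, 2k+1\<close> to its children. Planting the
  entries of \<open>x\<close> at pairwise incomparable nodes makes \<open>D\<close> act on \<open>a \<otimes> x\<close> as it acts on \<open>a\<close>, so an
  approximate eigenvector \<open>a\<close> of \<open>D\<close> on \<open>\<ell>\<^sup>p\<close> yields one on \<open>X\<close>, at the cost of a factor \<open>C\<^sup>2\<close>.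

  From (c) to (a) for finite \<open>p\<close>: use \<open>a \<otimes> x\<close> with \<open>a\<^sub>k = k\<close> to the power \<open>-1/p\<close>, \<open>k \<le> M\<close>, as the new building
  block. If \<open>b\<close> is normalised in \<open>\<ell>\<^sup>p\<close>, then some rearrangement of \<open>b \<otimes> a\<close> has \<open>\<ell>\<^sup>p\<close>-distance to \<open>a\<close> bounded
  independently of \<open>M\<close>, while the norm of \<open>a\<close> tends to infinity with \<open>M\<close>.

  From (d) back: an approximate eigenvector \<open>u\<close> satisfies that \<open>2\<^sup>m\<close> disjoint copies of \<open>u\<close> have norm close to
  \<open>\<lambda>\<^sup>m\<close>. For infinite \<open>p\<close> this is (a). For finite \<open>p\<close>, rounding weights to powers of \<open>\<lambda>\<close> gives (c).
\<close>

section \<open>Symmetric sequence spaces\<close>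


text \<open>Let \<open>A\<close> compete in the infimum for \<open>x\<close>. As \<open>g\<close> is
  injective on the support of \<open>y\<close>, at most \<open>k\<close> support indices are sent
  into \<open>A\<close>. Padding them to exactly \<open>k\<close> indices gives a competitor for
  \<open>y\<close> whose supremum is no larger.\<close>

lemma rearr_le:
  assumes bdd: "bdd_above (range (\<lambda>k. \<bar>x k\<bar>))" and inj: "inj_on g {i. y i \<noteq> 0}"
    and le: "\<And>i. y i \<noteq> 0 \<Longrightarrow> \<bar>y i\<bar> \<le> \<bar>x (g i)\<bar>"
  shows "rearr y k \<le> rearr x k"
proof -
  obtain B where B: "\<And>i. \<bar>x i\<bar> \<le> B"
    using bdd by (auto simp: bdd_above_def)
  have By: "\<bar>y i\<bar> \<le> B" for i
    using le[of i] B[of "g i"] B[of 0] by (cases "y i = 0") auto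
  have ne: "UNIV - A \<noteq> {}" if "finite A" for A :: "nat set"
    using that by (metis Diff_eq_empty_iff infinite_UNIV_nat top.extremum_uniqueI)
  have bx: "bdd_above ((\<lambda>i. \<bar>x i\<bar>) ` S)" "bdd_above ((\<lambda>i. \<bar>y i\<bar>) ` S)" for S
    using B By by (auto intro!: bdd_aboveI[of _ B])
  have nonneg: "0 \<le> Sup ((\<lambda>i. \<bar>z i\<bar>) ` (UNIV - A))"
    if fin: "finite A" and bd: "bdd_above ((\<lambda>i. \<bar>z i\<bar>) ` (UNIV - A))" for A and z :: "nat \<Rightarrow> real"
  proof -
    obtain i where "i \<in> UNIV - A" using ne[OF fin] by blast
    then have "\<bar>z i\<bar> \<le> Sup ((\<lambda>i. \<bar>z i\<bar>) ` (UNIV - A))"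
      using bd \<open>i \<in> UNIV - A\<close> by (intro cSup_upper) auto
    then show ?thesis by linarith
  qed
  show ?thesis
    unfolding rearr_def
  proof (rule cInf_mono)
    have "{..<k} \<in> {A. finite A \<and> card A = k}" by simp
    then show "(\<lambda>A. Sup ((\<lambda>i. \<bar>x i\<bar>) ` (UNIV - A))) ` {A. finite A \<and> card A = k} \<noteq> {}" by blast
    show "bdd_below ((\<lambda>A. Sup ((\<lambda>i. \<bar>y i\<bar>) ` (UNIV - A))) ` {A. finite A \<and> card A = k})"
    proof (rule bdd_belowI[of _ 0])
      fix r assume "r \<in> (\<lambda>A. Sup ((\<lambda>i. \<bar>y i\<bar>) ` (UNIV - A))) ` {A. finite A \<and> card A = k}"
      then obtain A where "finite A" "r = Sup ((\<lambda>i. \<bar>y i\<bar>) ` (UNIV - A))" by blast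
      then show "0 \<le> r" using nonneg[of A y] bx by simp
    qed
  next
    fix s assume "s \<in> (\<lambda>A. Sup ((\<lambda>i. \<bar>x i\<bar>) ` (UNIV - A))) ` {A. finite A \<and> card A = k}"
    then obtain A where A: "finite A" "card A = k" and s: "s = Sup ((\<lambda>i. \<bar>x i\<bar>) ` (UNIV - A))"
      by blast
    define B0 where "B0 = {i. y i \<noteq> 0 \<and> g i \<in> A}"
    have injB: "inj_on g B0" by (rule inj_on_subset[OF inj]) (auto simp: B0_def)
    have "g ` B0 \<subseteq> A" by (auto simp: B0_def)
    then have fB: "finite B0" and cB: "card B0 \<le> k"
      using injB A by (auto intro: inj_on_finite card_inj_on_le)
    obtain C where C: "finite C" "card C = k - card B0" "C \<subseteq> UNIV - B0"
      using infinite_arbitrarily_large[of "UNIV - B0" "k - card B0"] fB by auto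
    define B1 where "B1 = B0 \<union> C"
    have "card B1 = card B0 + card C"
      unfolding B1_def using C fB by (intro card_Un_disjoint) auto
    then have B1: "B0 \<subseteq> B1" "finite B1" "card B1 = k"
      using C fB cB by (auto simp: B1_def)
    have "Sup ((\<lambda>i. \<bar>y i\<bar>) ` (UNIV - B1)) \<le> s"
    proof (rule cSup_least)
      show "(\<lambda>i. \<bar>y i\<bar>) ` (UNIV - B1) \<noteq> {}" using ne[OF B1(2)] by blast
      fix r assume "r \<in> (\<lambda>i. \<bar>y i\<bar>) ` (UNIV - B1)"
      then obtain i where i: "i \<notin> B1" "r = \<bar>y i\<bar>" by blast
      show "r \<le> s"
      proof (cases "y i = 0")
        case True then show ?thesis using nonneg[OF A(1) bx(1)] i s by simp
      next
        case False
        then have "g i \<notin> A" using i B1 by (auto simp: B0_def)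
        then have "\<bar>x (g i)\<bar> \<le> s" unfolding s by (intro cSup_upper bx) auto
        then show ?thesis using le[OF False] i by simp
      qed
    qed
    then show "\<exists>a\<in>(\<lambda>A. Sup ((\<lambda>i. \<bar>y i\<bar>) ` (UNIV - A))) ` {A. finite A \<and> card A = k}. a \<le> s"
      using B1 by blast
  qed
qed

text \<open>Entry \<open>j\<close> of the \<open>k\<close>-th copy is stored at index \<open>prod_encode (k, j)\<close>.\<close>

definition tens :: "(nat \<Rightarrow> real) \<Rightarrow> (nat \<Rightarrow> real) \<Rightarrow> nat \<Rightarrow> real" where
  "tens a x i = a (fst (prod_decode i)) * x (snd (prod_decode i))"

text \<open>The column index keeps the summands apart, so the supports of the \<open>f l\<close> may
  overlap. Both weighted copies of one vector and families \<open>(Dop ^^ c l) u\<close> are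
  expressed in this form.\<close>

definition dsum :: "nat set \<Rightarrow> (nat \<Rightarrow> nat \<Rightarrow> real) \<Rightarrow> nat \<Rightarrow> real" where
  "dsum A f i = (if fst (prod_decode i) \<in> A then f (fst (prod_decode i)) (snd (prod_decode i)) else 0)"

definition trunc :: "nat \<Rightarrow> (nat \<Rightarrow> real) \<Rightarrow> nat \<Rightarrow> real" where
  "trunc n a k = (if k < n then a k else 0)"

text \<open>In terms of the node number \<open>i + 1\<close>, \<open>Dop\<close> reads the value at
  the parent, and \<open>m\<close> applications read it at the ancestor \<open>m\<close> levels up.
  Nodes below \<open>2 ^ m\<close> have no such ancestor and receive 0.\<close>

lemma Dop_power: "(Dop ^^ m) x i = (if i + 1 < 2 ^ m then 0 else x ((i + 1) div 2 ^ m - 1))"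
proof (induction m arbitrary: i)
  case 0 then show ?case by simp
next
  case (Suc m)
  show ?case
  proof (cases "i = 0")
    case True then show ?thesis using one_less_power[of "2::nat" "Suc m"] by (simp add: Dop_def)
  next
    case False
    define j where "j = (i + 1) div 2 - 1"
    have j: "j + 1 = (i + 1) div 2" using False by (simp add: j_def)
    have "(i + 1) div 2 < 2 ^ m \<longleftrightarrow> i + 1 < 2 ^ Suc m"
      by (metis less_mult_imp_div_less power_Suc2 div_less_iff_less_mult zero_less_numeral)
    moreover have "(i + 1) div 2 div 2 ^ m = (i + 1) div 2 ^ Suc m"
      by (simp add: div_mult2_eq)
    moreover have "(Dop ^^ Suc m) x i = (Dop ^^ m) x j"
      using False by (simp add: Dop_def j_def)
    ultimately show ?thesis using Suc[of j] j by simp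
  qed
qed

section \<open>The norm axioms in usable form and invariance under rearrangement\<close>

locale symm_space =
  fixes X :: "(nat \<Rightarrow> real) set" and N :: "(nat \<Rightarrow> real) \<Rightarrow> real"
  assumes symm: "symmetric_seq_space X N"
begin

lemma lattice: "banach_seq_lattice X N"
  using symm by (simp add: symmetric_seq_space_def)

lemmas lattice_conjs = lattice[unfolded banach_seq_lattice_def]

lemma zero_mem: "(\<lambda>k. 0) \<in> X"
  by (rule lattice_conjs[THEN conjunct1])

lemma add_mem: "x \<in> X \<Longrightarrow> y \<in> X \<Longrightarrow> (\<lambda>k. x k + y k) \<in> X"
  using lattice_conjs[THEN conjunct2, THEN conjunct1] by blast

lemma scale_mem: "x \<in> X \<Longrightarrow> (\<lambda>k. c * x k) \<in> X"
  using lattice_conjs[THEN conjunct2, THEN conjunct2, THEN conjunct1] by blast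

lemmas norm_conjs = lattice_conjs[THEN conjunct2, THEN conjunct2, THEN conjunct2]

lemma N_nonneg: "x \<in> X \<Longrightarrow> 0 \<le> N x"
  using norm_conjs[THEN conjunct1] by blast

lemma N_eq_0_iff: "x \<in> X \<Longrightarrow> N x = 0 \<longleftrightarrow> x = (\<lambda>k. 0)"
  using norm_conjs[THEN conjunct2, THEN conjunct1] by blast

lemma N_scale: "x \<in> X \<Longrightarrow> N (\<lambda>k. c * x k) = \<bar>c\<bar> * N x"
  using norm_conjs[THEN conjunct2, THEN conjunct2, THEN conjunct1] by blast

lemma N_triangle: "x \<in> X \<Longrightarrow> y \<in> X \<Longrightarrow> N (\<lambda>k. x k + y k) \<le> N x + N y"
  using norm_conjs[THEN conjunct2, THEN conjunct2, THEN conjunct2, THEN conjunct1] by blast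

lemma N_complete:
  assumes "\<And>n. f n \<in> X" "\<And>e. e > 0 \<Longrightarrow> \<exists>M. \<forall>m\<ge>M. \<forall>n\<ge>M. N (\<lambda>k. f m k - f n k) < e"
  obtains x where "x \<in> X" "(\<lambda>n. N (\<lambda>k. f n k - x k)) \<longlonglongrightarrow> 0"
  using norm_conjs[THEN conjunct2, THEN conjunct2, THEN conjunct2, THEN conjunct2, THEN conjunct1,
    THEN spec[of _ f]] assms by blast

lemma ideal: "x \<in> X \<Longrightarrow> (\<And>k. \<bar>y k\<bar> \<le> \<bar>x k\<bar>) \<Longrightarrow> y \<in> X"
  and N_mono: "x \<in> X \<Longrightarrow> (\<And>k. \<bar>y k\<bar> \<le> \<bar>x k\<bar>) \<Longrightarrow> N y \<le> N x"
  using norm_conjs[THEN conjunct2, THEN conjunct2, THEN conjunct2, THEN conjunct2, THEN conjunct2]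
  by blast+

lemma bdd: "x \<in> X \<Longrightarrow> bdd_above (range (\<lambda>k. \<bar>x k\<bar>))"
  and rearrangement_invariant:
    "x \<in> X \<Longrightarrow> bdd_above (range (\<lambda>k. \<bar>y k\<bar>)) \<Longrightarrow> rearr y = rearr x \<Longrightarrow> y \<in> X \<and> N y = N x"
  using symm[unfolded symmetric_seq_space_def] by metis+

lemma N_zero: "N (\<lambda>k. 0) = 0"
  using N_eq_0_iff zero_mem by blast

lemma diff_mem: "x \<in> X \<Longrightarrow> y \<in> X \<Longrightarrow> (\<lambda>k. x k - y k) \<in> X"
  using add_mem[of x "\<lambda>k. (-1) * y k"] scale_mem[of y "-1"] by simp

lemma N_diff_le: "x \<in> X \<Longrightarrow> y \<in> X \<Longrightarrow> N (\<lambda>k. x k - y k) \<le> N x + N y"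
  using N_triangle[of x "\<lambda>k. (-1) * y k"] scale_mem[of y "-1"] N_scale[of y "-1"] by simp

lemma N_le_diff: "x \<in> X \<Longrightarrow> y \<in> X \<Longrightarrow> N x \<le> N y + N (\<lambda>k. x k - y k)"
  using N_triangle[of y "\<lambda>k. x k - y k"] diff_mem[of x y] by simp

lemma N_abs_cong:
  assumes "x \<in> X" "\<And>k. \<bar>y k\<bar> = \<bar>x k\<bar>"
  shows "y \<in> X" "N y = N x"
proof -
  show y: "y \<in> X" by (rule ideal[OF assms(1)]) (simp add: assms(2))
  have "N y \<le> N x" by (rule N_mono[OF assms(1)]) (simp add: assms(2))
  moreover have "N x \<le> N y" by (rule N_mono[OF y]) (simp add: assms(2))
  ultimately show "N y = N x" by simp
qed

lemma sum_mem_and_bound: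
  assumes "finite A" "\<And>l. l \<in> A \<Longrightarrow> f l \<in> X"
  shows "(\<lambda>k. \<Sum>l\<in>A. f l k) \<in> X \<and> N (\<lambda>k. \<Sum>l\<in>A. f l k) \<le> (\<Sum>l\<in>A. N (f l))"
  using assms
proof (induction A rule: finite_induct)
  case empty then show ?case by (simp add: zero_mem N_zero)
next
  case (insert l A)
  then show ?case
    using add_mem[of "f l" "\<lambda>k. \<Sum>l\<in>A. f l k"] N_triangle[of "f l" "\<lambda>k. \<Sum>l\<in>A. f l k"] by auto
qed

text \<open>The common tool for comparing norms of copies. Restrict \<open>x\<close> to the image of
  the support, giving \<open>w\<close>, and transport it back along \<open>g\<close>, giving
  \<open>z\<close>. By \<open>rearr_le\<close> in both directions, \<open>w\<close> and
  \<open>z\<close> have equal rearrangements, and \<open>y\<close> lies below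
  \<open>z\<close>.\<close>

lemma rearrange_dominated:
  assumes x: "x \<in> X" and inj: "inj_on g {i. y i \<noteq> 0}"
    and le: "\<And>i. y i \<noteq> 0 \<Longrightarrow> \<bar>y i\<bar> \<le> \<bar>x (g i)\<bar>"
  shows "y \<in> X" "N y \<le> N x"
proof -
  let ?S = "{i. y i \<noteq> 0}"
  define w where "w j = (if j \<in> g ` ?S then x j else 0)" for j
  define z where "z i = (if i \<in> ?S then x (g i) else 0)" for i
  have wx: "\<bar>w j\<bar> \<le> \<bar>x j\<bar>" for j by (simp add: w_def)
  have w: "w \<in> X" "N w \<le> N x" by (rule ideal[OF x wx], rule N_mono[OF x wx])
  have bw: "bdd_above (range (\<lambda>k. \<bar>w k\<bar>))" by (rule bdd[OF w(1)])
  then obtain B where B: "\<And>k. \<bar>w k\<bar> \<le> B" by (auto simp: bdd_above_def)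
  have zw: "z i = w (g i)" if "z i \<noteq> 0" for i using that by (auto simp: z_def w_def)
  have bz: "bdd_above (range (\<lambda>k. \<bar>z k\<bar>))"
  proof (rule bdd_aboveI2[of _ _ B])
    fix k show "\<bar>z k\<bar> \<le> B" using zw[of k] B[of "g k"] by (cases "z k = 0") auto
  qed
  have "rearr z k \<le> rearr w k" for k
  proof (rule rearr_le[OF bw, of g])
    show "inj_on g {i. z i \<noteq> 0}"
      by (rule inj_on_subset[OF inj]) (auto simp: z_def split: if_splits)
    show "\<bar>z i\<bar> \<le> \<bar>w (g i)\<bar>" if "z i \<noteq> 0" for i
      using zw[OF that] by simp
  qed
  moreover have "rearr w k \<le> rearr z k" for k
  proof (rule rearr_le[OF bz, of "inv_into ?S g"])
    show "inj_on (inv_into ?S g) {i. w i \<noteq> 0}"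
      by (rule inj_on_subset[OF inj_on_inv_into[OF subset_refl]]) (auto simp: w_def split: if_splits)
    fix i assume "w i \<noteq> 0"
    then have "i \<in> g ` ?S" by (auto simp: w_def split: if_splits)
    then show "\<bar>w i\<bar> \<le> \<bar>z (inv_into ?S g i)\<bar>"
      using inv_into_into[of i g ?S] f_inv_into_f[of i g ?S] by (simp add: w_def z_def)
  qed
  ultimately have "rearr z = rearr w" by (auto intro: antisym)
  then have z: "z \<in> X" "N z = N w" using rearrangement_invariant[OF w(1) bz] by auto
  have yz: "\<bar>y i\<bar> \<le> \<bar>z i\<bar>" for i using le[of i] by (auto simp: z_def)
  show "y \<in> X" by (rule ideal[OF z(1) yz])
  show "N y \<le> N x" using N_mono[OF z(1) yz] z w by simp
qed

lemma dsum_mem: "finite A \<Longrightarrow> (\<And>l. l \<in> A \<Longrightarrow> f l \<in> X) \<Longrightarrow> dsum A f \<in> X"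
  and N_dsum_le: "finite A \<Longrightarrow> (\<And>l. l \<in> A \<Longrightarrow> f l \<in> X) \<Longrightarrow> N (dsum A f) \<le> (\<Sum>l\<in>A. N (f l))"
proof -
  assume A: "finite A" and f: "\<And>l. l \<in> A \<Longrightarrow> f l \<in> X"
  define F where "F l = dsum {l} f" for l
  have F: "F l \<in> X \<and> N (F l) \<le> N (f l)" if "l \<in> A" for l
  proof -
    have "inj_on (\<lambda>i. snd (prod_decode i)) {i. F l i \<noteq> 0}"
      by (auto intro!: inj_onI simp: F_def dsum_def split: if_splits)
         (metis prod.expand prod_decode_inverse)
    then show ?thesis
      using rearrange_dominated[OF f[OF that], of "\<lambda>i. snd (prod_decode i)" "F l"]
      by (simp add: F_def dsum_def)
  qed
  have eq: "dsum A f = (\<lambda>k. \<Sum>l\<in>A. F l k)"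
    using A by (auto simp: F_def dsum_def fun_eq_iff if_distrib sum.delta' cong: if_cong)
  have "(\<Sum>l\<in>A. N (F l)) \<le> (\<Sum>l\<in>A. N (f l))" using F by (intro sum_mono) auto
  moreover have "dsum A f \<in> X \<and> N (dsum A f) \<le> (\<Sum>l\<in>A. N (F l))"
    unfolding eq using sum_mem_and_bound[OF A, of F] F by blast
  ultimately show "dsum A f \<in> X" "N (dsum A f) \<le> (\<Sum>l\<in>A. N (f l))" by auto
qed

lemma tens_eq_dsum: "(\<And>k. k \<notin> A \<Longrightarrow> a k = 0) \<Longrightarrow> tens a x = dsum A (\<lambda>l i. a l * x i)"
  by (auto simp: tens_def dsum_def)

lemma tens_mem:
  assumes "finite {k. a k \<noteq> 0}" "x \<in> X" shows "tens a x \<in> X"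
  using tens_eq_dsum[of "{k. a k \<noteq> 0}" a x] dsum_mem[OF assms(1), of "\<lambda>l i. a l * x i"]
  by (auto simp: scale_mem[OF assms(2)])

lemma N_tens_le:
  assumes "finite A" "\<And>k. k \<notin> A \<Longrightarrow> a k = 0" "x \<in> X"
  shows "N (tens a x) \<le> (\<Sum>k\<in>A. \<bar>a k\<bar>) * N x"
  using tens_eq_dsum[of A a x] N_dsum_le[OF assms(1), of "\<lambda>l i. a l * x i"] assms
  by (auto simp: scale_mem N_scale sum_distrib_right)

lemma N_tens_mono:
  assumes fin: "finite {k. a' k \<noteq> 0}" and x: "x \<in> X" and h: "inj_on h {k. a k \<noteq> 0}"
    and le: "\<And>k. a k \<noteq> 0 \<Longrightarrow> \<bar>a k\<bar> \<le> \<bar>a' (h k)\<bar>"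
  shows "N (tens a x) \<le> N (tens a' x)"
proof (rule rearrange_dominated[OF tens_mem[OF fin x]])
  let ?g = "\<lambda>i. prod_encode (h (fst (prod_decode i)), snd (prod_decode i))"
  show "inj_on ?g {i. tens a x i \<noteq> 0}"
  proof (rule inj_onI)
    fix i j assume "i \<in> {i. tens a x i \<noteq> 0}" "j \<in> {i. tens a x i \<noteq> 0}" "?g i = ?g j"
    then have "fst (prod_decode i) = fst (prod_decode j)" "snd (prod_decode i) = snd (prod_decode j)"
      by (auto simp: tens_def intro: inj_onD[OF h])
    then show "i = j" by (metis prod.expand prod_decode_inverse)
  qed
  show "\<bar>tens a x i\<bar> \<le> \<bar>tens a' x (?g i)\<bar>" if "tens a x i \<noteq> 0" for i
    using that le[of "fst (prod_decode i)"] by (auto simp: tens_def abs_mult intro!: mult_right_mono)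
qed

text \<open>Both vectors have the same entries. Their positions differ by rebracketing a triple of
  indices, and \<open>g\<close> and \<open>h\<close> do this in the two directions.\<close>

lemma N_tens_assoc:
  assumes b: "finite {k. b k \<noteq> 0}" and a: "finite {k. a k \<noteq> 0}" and x: "x \<in> X"
  shows "N (tens b (tens a x)) = N (tens (tens b a) x)"
proof -
  have "{i. tens b a i \<noteq> 0} \<subseteq> prod_encode ` ({k. b k \<noteq> 0} \<times> {k. a k \<noteq> 0})"
  proof
    fix i assume "i \<in> {i. tens b a i \<noteq> 0}"
    then have "prod_decode i \<in> {k. b k \<noteq> 0} \<times> {k. a k \<noteq> 0}" by (cases "prod_decode i") (auto simp: tens_def)
    then show "i \<in> prod_encode ` ({k. b k \<noteq> 0} \<times> {k. a k \<noteq> 0})" by (metis imageI prod_decode_inverse)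
  qed
  then have fin: "finite {i. tens b a i \<noteq> 0}" using a b by (meson finite_SigmaI finite_imageI finite_subset)
  define g where "g i = prod_encode (prod_encode (fst (prod_decode i), fst (prod_decode (snd (prod_decode i)))),
      snd (prod_decode (snd (prod_decode i))))" for i
  define h where "h i = prod_encode (fst (prod_decode (fst (prod_decode i))),
      prod_encode (snd (prod_decode (fst (prod_decode i))), snd (prod_decode i)))" for i
  have inj: "inj_on g S" "inj_on h S" for S
    by (rule inj_on_inverseI[of _ h], simp add: g_def h_def)
       (rule inj_on_inverseI[of _ g], simp add: g_def h_def)
  have "N (tens b (tens a x)) \<le> N (tens (tens b a) x)"
    by (rule rearrange_dominated(2)[OF tens_mem[OF fin x] inj(1)]) (simp add: tens_def g_def)
  moreover have "N (tens (tens b a) x) \<le> N (tens b (tens a x))"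
    by (rule rearrange_dominated(2)[OF tens_mem[OF b tens_mem[OF a x]] inj(2)]) (simp add: tens_def h_def)
  ultimately show ?thesis by simp
qed

text \<open>Within the support of \<open>Dop x\<close>, halving is injective on the even and on the
  odd positions separately, so each half \<open>P b\<close> is dominated by one copy of
  \<open>x\<close>.\<close>

lemma Dop_mem: "x \<in> X \<Longrightarrow> Dop x \<in> X" and N_Dop_le: "x \<in> X \<Longrightarrow> N (Dop x) \<le> 2 * N x"
proof -
  assume x: "x \<in> X"
  define P where "P b i = (if even i = b then Dop x i else 0)" for b i
  have P: "P b \<in> X" "N (P b) \<le> N x" for b
  proof -
    have inj: "inj_on (\<lambda>i. (i + 1) div 2 - 1) {i. P b i \<noteq> 0}"
    proof (rule inj_onI)
      fix i j assume ij: "i \<in> {i. P b i \<noteq> 0}" "j \<in> {i. P b i \<noteq> 0}" "(i + 1) div 2 - 1 = (j + 1) div 2 - 1"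
      then have "even i = even j" "i \<noteq> 0" "j \<noteq> 0" by (auto simp: P_def Dop_def split: if_splits)
      then show "i = j" using ij(3) by presburger
    qed
    have le: "\<bar>P b i\<bar> \<le> \<bar>x ((i + 1) div 2 - 1)\<bar>" for i by (simp add: P_def Dop_def)
    show "P b \<in> X" "N (P b) \<le> N x" using rearrange_dominated[OF x inj le] by auto
  qed
  have eq: "Dop x = (\<lambda>i. P True i + P False i)" by (auto simp: P_def)
  show "Dop x \<in> X" unfolding eq by (rule add_mem[OF P(1) P(1)])
  have "N (Dop x) \<le> N (P True) + N (P False)" unfolding eq by (rule N_triangle[OF P(1) P(1)])
  then show "N (Dop x) \<le> 2 * N x" using P(2)[of True] P(2)[of False] by linarith
qed

end


section \<open>Order continuity and disjoint copies\<close>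

lemma ereal_ge_1_cases:
  assumes "1 \<le> (p::ereal)"
  obtains "p = \<infinity>" | "p \<noteq> \<infinity>" "1 \<le> real_of_ereal p"
  using assms by (cases p) auto

lemma pnorm_finite:
  "p \<noteq> \<infinity> \<Longrightarrow> pnorm p n a = (\<Sum>k<n. \<bar>a k\<bar> powr real_of_ereal p) powr (1 / real_of_ereal p)"
  by (simp add: pnorm_def)

lemma pnorm_powr:
  assumes "p \<noteq> \<infinity>" "1 \<le> real_of_ereal p"
  shows "pnorm p n a powr real_of_ereal p = (\<Sum>k<n. \<bar>a k\<bar> powr real_of_ereal p)"
  using assms by (simp add: pnorm_finite powr_powr sum_nonneg)

lemma pnorm_ge_coord:
  assumes p: "1 \<le> p" and k: "k < n"
  shows "\<bar>a k\<bar> \<le> pnorm p n a"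
  using p
proof (cases rule: ereal_ge_1_cases)
  case 1
  then show ?thesis using k by (auto simp: pnorm_def intro!: Max_ge)
next
  case 2
  define P where "P = real_of_ereal p"
  have "\<bar>a k\<bar> powr P \<le> (\<Sum>k<n. \<bar>a k\<bar> powr P)"
    using k by (intro member_le_sum) auto
  then have "(\<bar>a k\<bar> powr P) powr (1 / P) \<le> (\<Sum>k<n. \<bar>a k\<bar> powr P) powr (1 / P)"
    using 2 by (intro powr_mono2) (auto simp: P_def)
  then show ?thesis using 2 by (simp add: pnorm_finite P_def powr_powr)
qed

lemma pnorm_nonneg:
  assumes "1 \<le> p" "0 < n" shows "0 \<le> pnorm p n a"
  using pnorm_ge_coord[OF assms, of a] by linarith

lemma pnorm_cong: "(\<And>k. k < n \<Longrightarrow> \<bar>a k\<bar> = \<bar>b k\<bar>) \<Longrightarrow> pnorm p n a = pnorm p n b"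
  by (auto simp: pnorm_def intro!: arg_cong[of _ _ Max] arg_cong2[of _ _ _ _ "(powr)"] sum.cong image_cong)

lemma pnorm_scale:
  assumes "1 \<le> p" "0 < n"
  shows "pnorm p n (\<lambda>k. c * a k) = \<bar>c\<bar> * pnorm p n a"
  using assms(1)
proof (cases rule: ereal_ge_1_cases)
  case 1
  have "mono (\<lambda>r::real. \<bar>c\<bar> * r)" by (simp add: mono_def mult_left_mono)
  then have "Max ((\<lambda>r. \<bar>c\<bar> * r) ` ((\<lambda>k. \<bar>a k\<bar>) ` {..<n})) = \<bar>c\<bar> * Max ((\<lambda>k. \<bar>a k\<bar>) ` {..<n})"
    using assms(2) by (intro mono_Max_commute[symmetric]) auto
  then show ?thesis using 1 by (simp add: pnorm_def image_image abs_mult)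
next
  case 2
  then show ?thesis
    by (simp add: pnorm_finite abs_mult powr_mult sum_distrib_left[symmetric] sum_nonneg powr_powr)
qed

lemma finite_trunc: "finite {k. trunc n a k \<noteq> 0}"
  by (rule finite_subset[of _ "{..<n}"]) (auto simp: trunc_def)

lemma trunc_eq: "(\<And>k. n \<le> k \<Longrightarrow> a k = 0) \<Longrightarrow> trunc n a = a"
  by (auto simp: trunc_def fun_eq_iff)

lemma tens_scale_left: "tens (\<lambda>k. c * a k) x = (\<lambda>i. c * tens a x i)"
  and tens_scale_right: "tens a (\<lambda>i. c * x i) = (\<lambda>i. c * tens a x i)"
  and tens_diff_left: "tens (\<lambda>k. a k - b k) x = (\<lambda>i. tens a x i - tens b x i)"
  and tens_diff_right: "tens a (\<lambda>i. x i - y i) = (\<lambda>i. tens a x i - tens a y i)"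
  by (auto simp: tens_def algebra_simps)

lemma lincomb_disjoint:
  assumes "disjointly_supported n x" "k < n" "x k i \<noteq> 0"
  shows "lincomb n a x i = a k * x k i"
proof -
  have "lincomb n a x i = (\<Sum>l<n. if l = k then a k * x k i else 0)"
    unfolding lincomb_def
  proof (rule sum.cong)
    fix l assume "l \<in> {..<n}"
    then have "l \<noteq> k \<Longrightarrow> x l i = 0"
      using assms unfolding disjointly_supported_def by blast
    then show "a l * x l i = (if l = k then a k * x k i else 0)" by auto
  qed simp
  then show ?thesis using assms(2) by simp
qed

section \<open>Separability forces the norms of tails to tend to 0\<close>

context symm_space
begin

lemma norm_singleton_pos:
  assumes "x \<in> X" "x i \<noteq> 0"
  shows "0 < N (\<lambda>k. if k = i then x i else 0)"
proof -
  have m: "(\<lambda>k. if k = i then x i else 0) \<in> X" by (rule ideal[OF assms(1)]) auto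
  moreover have "(\<lambda>k. if k = i then x i else 0) \<noteq> (\<lambda>k. 0)" using assms(2) by metis
  ultimately show ?thesis using N_nonneg[OF m] N_eq_0_iff[OF m] by linarith
qed

text \<open>Sums over different sets of blocks are at distance at least \<open>d\<close>, and there are uncountably many of them.\<close>

lemma separated_blocks_imp_not_separable:
  assumes x: "x \<in> X" and s: "strict_mono (s :: nat \<Rightarrow> nat)" and d: "0 < d"
    and blk: "\<And>j. d \<le> N (\<lambda>i. if s j \<le> i \<and> i < s (Suc j) then x i else 0)"
  shows "\<not> separable_seq_space X N"
proof
  assume "separable_seq_space X N"
  then obtain S where S: "countable S" "S \<subseteq> X" "\<And>x e. x \<in> X \<Longrightarrow> e > 0 \<Longrightarrow> \<exists>s\<in>S. N (\<lambda>k. x k - s k) < e"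
    unfolding separable_seq_space_def by metis
  define y where "y A i = (if \<exists>j\<in>A. s j \<le> i \<and> i < s (Suc j) then x i else 0)" for A i
  have y: "y A \<in> X" for A by (rule ideal[OF x]) (simp add: y_def)
  obtain q where q: "\<And>A. q A \<in> S" "\<And>A. N (\<lambda>k. y A k - q A k) < d / 2"
    using S(3)[OF y, of "d / 2"] d by (metis half_gt_zero)
  have uniq: "j = l" if "s j \<le> i" "i < s (Suc j)" "s l \<le> i" "i < s (Suc l)" for i j l
  proof (rule ccontr)
    assume "j \<noteq> l"
    then consider "Suc j \<le> l" | "Suc l \<le> j" by linarith
    then show False
      using that strict_mono_less_eq[OF s, of "Suc j" l] strict_mono_less_eq[OF s, of "Suc l" j] by cases auto
  qed
  have far: "d \<le> N (\<lambda>k. y A k - y B k)" if "j \<in> A" "j \<notin> B" for A B j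
  proof -
    have "\<bar>if s j \<le> i \<and> i < s (Suc j) then x i else 0\<bar> \<le> \<bar>y A i - y B i\<bar>" for i
      using that uniq[of j i] by (auto simp: y_def)
    then have "N (\<lambda>i. if s j \<le> i \<and> i < s (Suc j) then x i else 0) \<le> N (\<lambda>k. y A k - y B k)"
      by (intro N_mono diff_mem y)
    then show ?thesis using blk[of j] by linarith
  qed
  \<comment> \<open>Equal approximants would put \<open>y A\<close> and \<open>y B\<close> at
    distance below \<open>d\<close>. Hence \<open>q\<close> embeds the power set of the naturals
    into a countable set.\<close>
  have far': "A = B" if "q A = q B" for A B
  proof (rule ccontr)
    assume "A \<noteq> B"
    then obtain j where "j \<in> A \<and> j \<notin> B \<or> j \<in> B \<and> j \<notin> A" by blast
    moreover have "N (\<lambda>k. y A k - y B k) < d" if "q A = q B" for A B :: "nat set"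
    proof -
      have qA: "q A \<in> X" "q B \<in> X" using q S by auto
      have "N (\<lambda>k. (y A k - q A k) - (y B k - q B k)) \<le> N (\<lambda>k. y A k - q A k) + N (\<lambda>k. y B k - q B k)"
        by (intro N_diff_le diff_mem y qA)
      then show ?thesis using q(2)[of A] q(2)[of B] that by simp
    qed
    moreover have "q B = q A" using that by simp
    ultimately show False using far[of j A B] far[of j B A] that by (meson not_less)
  qed
  then have "inj q" by (simp add: inj_def)
  moreover have "countable (range q)" by (rule countable_subset[OF _ S(1)]) (use q in auto)
  ultimately have "countable (UNIV :: nat set set)" using countable_image_inj_on by blast
  then obtain f :: "nat \<Rightarrow> nat set" where "range f = UNIV"
    using uncountable_def[of "UNIV :: nat set set"] by auto
  then show False using Cantors_theorem[of UNIV] by auto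
qed

text \<open>If the truncations \<open>f n\<close> were not Cauchy, consecutive blocks of norm at
  least \<open>d\<close> could be cut out of \<open>x\<close>, which
  \<open>separated_blocks_imp_not_separable\<close> excludes. Their limit is \<open>x\<close>, since
  the norm controls each coordinate.\<close>

lemma tail_small:
  assumes sep: "separable_seq_space X N" and x: "x \<in> X" and e: "0 < e"
  shows "\<exists>K. N (\<lambda>i. if i < K then 0 else x i) < e"
proof -
  define f where "f n i = (if i < n then x i else 0)" for n i
  have f: "f n \<in> X" for n by (rule ideal[OF x]) (simp add: f_def)
  have cauchy: "\<exists>M. \<forall>m\<ge>M. \<forall>n\<ge>M. N (\<lambda>k. f m k - f n k) < d" if d: "d > 0" for d
  proof (rule ccontr)
    assume contr: "\<not> ?thesis"
    have "\<exists>g>M. d \<le> N (\<lambda>i. if M \<le> i \<and> i < g then x i else 0)" for M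
    proof -
      obtain m n where mn: "M \<le> m" "M \<le> n" "d \<le> N (\<lambda>k. f m k - f n k)"
        using contr by (meson not_less)
      define g where "g = Suc (max m n)"
      have "(\<lambda>i. if M \<le> i \<and> i < g then x i else 0) \<in> X" by (rule ideal[OF x]) auto
      then have "N (\<lambda>k. f m k - f n k) \<le> N (\<lambda>i. if M \<le> i \<and> i < g then x i else 0)"
        by (rule N_mono) (use mn in \<open>auto simp: f_def g_def\<close>)
      then show ?thesis using mn by (intro exI[of _ g]) (auto simp: g_def)
    qed
    then obtain g where g: "\<And>M. M < g M" "\<And>M. d \<le> N (\<lambda>i. if M \<le> i \<and> i < g M then x i else 0)"
      by metis
    define s where "s j = (g ^^ j) 0" for j
    have "strict_mono s" by (rule strict_mono_Suc_iff[THEN iffD2]) (simp add: s_def g)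
    moreover have "d \<le> N (\<lambda>i. if s j \<le> i \<and> i < s (Suc j) then x i else 0)" for j
      using g(2)[of "s j"] by (simp add: s_def)
    ultimately show False
      using separated_blocks_imp_not_separable[OF x _ d] sep by blast
  qed
  obtain y where y: "y \<in> X" "(\<lambda>n. N (\<lambda>k. f n k - y k)) \<longlonglongrightarrow> 0"
    using N_complete[OF f cauchy] by blast
  have "x i = y i" for i
  proof (rule ccontr)
    assume ne: "x i \<noteq> y i"
    define z where "z k = (if k = i then x i - y i else 0)" for k
    have z: "0 < N z" using norm_singleton_pos[OF diff_mem[OF x y(1)], of i] ne unfolding z_def by simp
    have "N z \<le> N (\<lambda>k. f n k - y k)" if "n > i" for n
      by (rule N_mono[OF diff_mem[OF f y(1)]]) (use that in \<open>auto simp: z_def f_def\<close>)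
    then have "N z \<le> 0"
      by (intro LIMSEQ_le_const[OF y(2)]) (meson less_eq_Suc_le)
    then show False using z by simp
  qed
  then have "x = y" by auto
  then have "\<forall>\<^sub>F n in sequentially. N (\<lambda>k. f n k - x k) < e"
    using order_tendstoD(2)[OF y(2) e] by simp
  then obtain K where K: "N (\<lambda>k. f K k - x k) < e"
    using eventually_happens'[OF trivial_limit_sequentially] by blast
  have "N (\<lambda>i. if i < K then 0 else x i) \<le> N (\<lambda>k. f K k - x k)"
    by (rule N_mono[OF diff_mem[OF f x]]) (simp add: f_def)
  then show ?thesis using K by (intro exI[of _ K]) linarith
qed

text \<open>The two bounds carry separate constants, so that truncation can worsen the lower one
  alone. \<open>trunc\<close> discards the coordinates from \<open>n\<close> on, on which
  \<open>pnorm p n a\<close> does not depend.\<close>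

definition lp_copies :: "ereal \<Rightarrow> nat \<Rightarrow> (nat \<Rightarrow> real) \<Rightarrow> real \<Rightarrow> real \<Rightarrow> bool" where
  "lp_copies p n x c d \<longleftrightarrow> (\<forall>a. c * pnorm p n a \<le> N (tens (trunc n a) x) \<and>
     N (tens (trunc n a) x) \<le> d * pnorm p n a)"

text \<open>Passes from disjoint vectors of equal distribution to copies of the single vector
  \<open>x 0\<close>. The permutations \<open>\<pi> k\<close> match the entries, and disjointness
  determines the vector to which a position belongs, so there are injections in both
  directions.\<close>

lemma N_lincomb:
  assumes x: "\<And>k. k < n \<Longrightarrow> x k \<in> X" and n: "0 < n" and disj: "disjointly_supported n x"
    and dist: "\<And>j k. j < n \<Longrightarrow> k < n \<Longrightarrow> same_ord_dist (x j) (x k)"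
  shows "N (lincomb n a x) = N (tens (trunc n a) (x 0))"
proof -
  have "\<exists>\<pi>. bij \<pi> \<and> (\<forall>i. x k (\<pi> i) = x 0 i)" if "k < n" for k
    using dist[of 0 k] n that by (simp add: same_ord_dist_def)
  then obtain \<pi> where \<pi>: "\<And>k. k < n \<Longrightarrow> bij (\<pi> k)" "\<And>k i. k < n \<Longrightarrow> x k (\<pi> k i) = x 0 i"
    by metis
  have inv: "x 0 (inv (\<pi> k) i) = x k i" if "k < n" for k i
    using \<pi>(2)[OF that, of "inv (\<pi> k) i"] \<pi>(1)[OF that] by (simp add: bij_is_surj surj_f_inv_f)
  have T: "tens (trunc n a) (x 0) \<in> X" by (rule tens_mem[OF finite_trunc x[OF n]])
  have L: "lincomb n a x \<in> X"
    unfolding lincomb_def using sum_mem_and_bound[of "{..<n}" "\<lambda>k i. a k * x k i"] x scale_mem by auto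
  have ex: "\<exists>k<n. x k i \<noteq> 0 \<and> lincomb n a x i = a k * x k i" if nz: "lincomb n a x i \<noteq> 0" for i
  proof -
    obtain k where "k < n" "a k * x k i \<noteq> 0"
      using sum.not_neutral_contains_not_neutral[OF nz[unfolded lincomb_def]] by auto
    then show ?thesis using lincomb_disjoint[OF disj] by auto
  qed
  then obtain \<kappa> where \<kappa>: "\<And>i. lincomb n a x i \<noteq> 0 \<Longrightarrow>
      \<kappa> i < n \<and> x (\<kappa> i) i \<noteq> 0 \<and> lincomb n a x i = a (\<kappa> i) * x (\<kappa> i) i"
    by metis
  have "N (lincomb n a x) \<le> N (tens (trunc n a) (x 0))"
  proof (rule rearrange_dominated(2)[OF T])
    let ?g = "\<lambda>i. prod_encode (\<kappa> i, inv (\<pi> (\<kappa> i)) i)"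
    show "inj_on ?g {i. lincomb n a x i \<noteq> 0}"
    proof (rule inj_onI)
      fix i j assume "i \<in> {i. lincomb n a x i \<noteq> 0}" "j \<in> {i. lincomb n a x i \<noteq> 0}" "?g i = ?g j"
      then have "\<kappa> i < n" "inv (\<pi> (\<kappa> i)) i = inv (\<pi> (\<kappa> i)) j" using \<kappa> by auto
      then show "i = j" using \<pi>(1) by (metis bij_inv_eq_iff)
    qed
    fix i assume "lincomb n a x i \<noteq> 0"
    then show "\<bar>lincomb n a x i\<bar> \<le> \<bar>tens (trunc n a) (x 0) (?g i)\<bar>"
      using \<kappa>[of i] inv by (simp add: tens_def trunc_def)
  qed
  moreover have "N (tens (trunc n a) (x 0)) \<le> N (lincomb n a x)"
  proof (rule rearrange_dominated(2)[OF L])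
    let ?g = "\<lambda>i. \<pi> (fst (prod_decode i)) (snd (prod_decode i))"
    have nz: "fst (prod_decode i) < n" "x (fst (prod_decode i)) (?g i) \<noteq> 0"
      "tens (trunc n a) (x 0) i = a (fst (prod_decode i)) * x (fst (prod_decode i)) (?g i)"
      if "tens (trunc n a) (x 0) i \<noteq> 0" for i
      using that \<pi>(2) by (auto simp: tens_def trunc_def split: if_splits)
    show "inj_on ?g {i. tens (trunc n a) (x 0) i \<noteq> 0}"
    proof (rule inj_onI)
      fix i j assume ij: "i \<in> {i. tens (trunc n a) (x 0) i \<noteq> 0}" "j \<in> {i. tens (trunc n a) (x 0) i \<noteq> 0}"
        and eq: "?g i = ?g j"
      obtain k q l r where kl: "prod_decode i = (k, q)" "prod_decode j = (l, r)" by fastforce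
      then have k: "k < n" "x k (\<pi> k q) \<noteq> 0" "l < n" "x l (\<pi> k q) \<noteq> 0"
        using nz[of i] nz[of j] ij eq by auto
      then have "k = l" using disj unfolding disjointly_supported_def by blast
      moreover from this have "q = r"
        using eq bij_is_inj[OF \<pi>(1)[OF k(1)]] by (auto simp: kl dest: injD)
      ultimately show "i = j" using kl by (metis prod_decode_inverse)
    qed
    fix i assume "tens (trunc n a) (x 0) i \<noteq> 0"
    then show "\<bar>tens (trunc n a) (x 0) i\<bar> \<le> \<bar>lincomb n a x (?g i)\<bar>"
      using nz[of i] lincomb_disjoint[OF disj, of "fst (prod_decode i)" "?g i" a] by simp
  qed
  ultimately show ?thesis by simp
qed

end

text \<open>The first \<open>K\<close> entries of \<open>x\<close> are continued periodically, so
  block \<open>k\<close> is \<open>x\<close> shifted by \<open>k * K\<close>. Exchanging blocks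
  \<open>j\<close> and \<open>k\<close> is the required permutation of the indices.\<close>

lemma blocks_of_finite_support:
  assumes K: "0 < K" and sup: "\<And>i. K \<le> i \<Longrightarrow> x i = 0"
  defines "u \<equiv> \<lambda>k. block (\<lambda>i. x (i mod K)) (k * K) (Suc k * K)"
  shows "u 0 = x" "disjointly_supported n u" "same_ord_dist (u j) (u k)"
proof -
  have u: "u k i = (if i div K = k then x (i mod K) else 0)" for k i
  proof -
    have "k * K \<le> i \<and> i < Suc k * K \<longleftrightarrow> i div K = k"
      using K by (metis div_nat_eqI dividend_less_times_div div_times_less_eq_dividend mult.commute mult_Suc)
    then show ?thesis by (simp add: u_def block_def)
  qed
  show "u 0 = x"
  proof
    fix i show "u 0 i = x i" using sup[of i] K by (cases "i < K") (auto simp: u div_eq_0_iff)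
  qed
  show "disjointly_supported n u" by (auto simp: disjointly_supported_def u)
  define \<pi> where "\<pi> i = Transposition.transpose j k (i div K) * K + i mod K" for i
  have "\<pi> (\<pi> i) = i" for i using K by (simp add: \<pi>_def)
  then have "bij \<pi>" by (intro involuntory_imp_bij)
  moreover have "u k (\<pi> i) = u j i" for i
    using K by (auto simp: u \<pi>_def Transposition.transpose_def)
  ultimately show "same_ord_dist (u j) (u k)" by (auto simp: same_ord_dist_def)
qed

context symm_space
begin

lemma lp_copies_scale:
  assumes "lp_copies p n x c d" "x \<in> X"
  shows "lp_copies p n (\<lambda>i. r * x i) (\<bar>r\<bar> * c) (\<bar>r\<bar> * d)"
  using assms mult_left_mono[of _ _ "\<bar>r\<bar>"]
  by (auto simp: lp_copies_def tens_scale_right N_scale[OF tens_mem[OF finite_trunc]] mult.assoc)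

text \<open>The tail cut off has norm at most \<open>(c - c') / n\<close>. Its \<open>n\<close>
  copies have weights of size at most \<open>pnorm p n a\<close>, so the lower bound loses at most
  \<open>(c - c') * pnorm p n a\<close>; the upper bound survives by monotonicity of the
  norm.\<close>

lemma lp_copies_truncate:
  assumes sep: "separable_seq_space X N" and p: "1 \<le> p" and n: "0 < n" and x: "x \<in> X"
    and cop: "lp_copies p n x c d" and c': "c' < c"
  obtains y K where "y \<in> X" "0 < K" "\<And>i. K \<le> i \<Longrightarrow> y i = 0" "lp_copies p n y c' d"
proof -
  obtain K0 where K0: "N (\<lambda>i. if i < K0 then 0 else x i) < (c - c') / n"
    using tail_small[OF sep x, of "(c - c') / n"] c' n by auto
  \<comment> \<open>\<open>Suc\<close> makes the blocks nonempty, as the strictly increasing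
    endpoints in (a) demand.\<close>
  define K where "K = Suc K0"
  define z where "z i = (if i < K then 0 else x i)" for i
  define y where "y i = x i - z i" for i
  have z: "z \<in> X" by (rule ideal[OF x]) (simp add: z_def)
  have y: "y \<in> X" unfolding y_def by (rule diff_mem[OF x z])
  have "(\<lambda>i. if i < K0 then 0 else x i) \<in> X" by (rule ideal[OF x]) simp
  then have "N z \<le> N (\<lambda>i. if i < K0 then 0 else x i)"
    by (rule N_mono) (simp add: z_def K_def)
  then have Nz: "N z \<le> (c - c') / n" using K0 by simp
  have "lp_copies p n y c' d"
    unfolding lp_copies_def
  proof (intro allI conjI)
    fix a
    let ?a = "trunc n a"
    have "N (tens ?a x) \<le> N (tens ?a y) + N (tens ?a z)"
      using N_le_diff[of "tens ?a x" "tens ?a y"] tens_mem[OF finite_trunc x] tens_mem[OF finite_trunc y]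
      by (simp add: tens_diff_right[symmetric] y_def)
    moreover have "N (tens ?a z) \<le> (\<Sum>k<n. \<bar>?a k\<bar>) * N z"
      by (rule N_tens_le[OF _ _ z]) (auto simp: trunc_def)
    moreover have "(\<Sum>k<n. \<bar>?a k\<bar>) * N z \<le> (n * pnorm p n a) * ((c - c') / n)"
    proof (rule mult_mono[OF _ Nz])
      show "(\<Sum>k<n. \<bar>?a k\<bar>) \<le> n * pnorm p n a"
        using sum_bounded_above[of "{..<n}" "\<lambda>k. \<bar>?a k\<bar>" "pnorm p n a"] pnorm_ge_coord[OF p, of _ n a]
        by (simp add: trunc_def)
    qed (use pnorm_nonneg[OF p n] N_nonneg[OF z] in auto)
    moreover have "(n * pnorm p n a) * ((c - c') / n) = (c - c') * pnorm p n a"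
      using n by simp
    moreover have "c * pnorm p n a \<le> N (tens ?a x)" using cop by (simp add: lp_copies_def)
    ultimately show "c' * pnorm p n a \<le> N (tens ?a y)" by (simp add: algebra_simps)
    have "N (tens ?a y) \<le> N (tens ?a x)"
      by (rule N_mono[OF tens_mem[OF finite_trunc x]])
         (auto simp: tens_def y_def z_def abs_mult intro!: mult_left_mono)
    then show "N (tens ?a y) \<le> d * pnorm p n a" using cop unfolding lp_copies_def by (meson order_trans)
  qed
  then show ?thesis using that[of y K] y by (simp add: K_def y_def z_def)
qed

lemma crude_imp_lp_copies:
  assumes "crude_sym_fin_rep p X N"
  obtains C where "0 < C" "\<And>n. 1 \<le> n \<Longrightarrow> \<exists>x\<in>X. lp_copies p n x (1 / C) C"
proof -
  obtain C where C: "0 < C" and ex: "\<And>n. 1 \<le> n \<Longrightarrow> \<exists>x::nat \<Rightarrow> nat \<Rightarrow> real.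
        (\<forall>k<n. x k \<in> X) \<and> disjointly_supported n x \<and>
        (\<forall>j<n. \<forall>k<n. same_ord_dist (x j) (x k)) \<and>
        (\<forall>a. pnorm p n a / C \<le> N (lincomb n a x) \<and> N (lincomb n a x) \<le> C * pnorm p n a)"
    using assms unfolding crude_sym_fin_rep_def by blast
  have "\<exists>x\<in>X. lp_copies p n x (1 / C) C" if n: "1 \<le> n" for n
  proof -
    obtain x where x: "\<forall>k<n. x k \<in> X" "disjointly_supported n x" "\<forall>j<n. \<forall>k<n. same_ord_dist (x j) (x k)"
      "\<forall>a. pnorm p n a / C \<le> N (lincomb n a x) \<and> N (lincomb n a x) \<le> C * pnorm p n a"
      using ex[OF n] by blast
    have "N (lincomb n a x) = N (tens (trunc n a) (x 0))" for a
      using x n by (intro N_lincomb) auto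
    then have "lp_copies p n (x 0) (1 / C) C" using x(4) by (simp add: lp_copies_def)
    then show ?thesis using x(1) n by auto
  qed
  then show ?thesis using that C by blast
qed

text \<open>Serves (a) and (c) alike: after truncation the copies fit into consecutive intervals of
  length \<open>K\<close>, and the gap between \<open>c'\<close> and \<open>c\<close> pays for the
  truncation.\<close>

lemma lp_copies_imp_blocks:
  assumes sep: "separable_seq_space X N" and p: "1 \<le> p" and n: "0 < n" and x: "x \<in> X"
    and cop: "lp_copies p n x c d" and c': "c' < c"
  obtains \<alpha> K u where "0 < K" "u = (\<lambda>k. block \<alpha> (k * K) (Suc k * K))" "\<And>k. u k \<in> X"
    "disjointly_supported n u" "\<And>j k. same_ord_dist (u j) (u k)"
    "\<And>a. c' * pnorm p n a \<le> N (lincomb n a u) \<and> N (lincomb n a u) \<le> d * pnorm p n a"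
proof -
  obtain y K where y: "y \<in> X" "0 < K" "\<And>i. K \<le> i \<Longrightarrow> y i = 0" "lp_copies p n y c' d"
    using lp_copies_truncate[OF sep p n x cop c'] by blast
  define u where "u = (\<lambda>k. block (\<lambda>i. y (i mod K)) (k * K) (Suc k * K))"
  have blocks: "u 0 = y" "disjointly_supported n u" "\<And>j k. same_ord_dist (u j) (u k)"
    unfolding u_def by (rule blocks_of_finite_support[OF y(2)], erule y(3))+
  have uX: "u k \<in> X" for k
  proof -
    obtain \<pi> where \<pi>: "bij \<pi>" "\<And>i. u 0 (\<pi> i) = u k i" using blocks(3)[of k 0] by (auto simp: same_ord_dist_def)
    show ?thesis
      by (rule rearrange_dominated(1)[OF y(1), of \<pi>])
         (use \<pi> blocks(1) in \<open>auto intro: inj_on_subset[OF bij_is_inj]\<close>)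
  qed
  have "N (lincomb n a u) = N (tens (trunc n a) y)" for a
    using N_lincomb[of n u a] uX blocks n by simp
  then have "c' * pnorm p n a \<le> N (lincomb n a u) \<and> N (lincomb n a u) \<le> d * pnorm p n a" for a
    using y(4) by (simp add: lp_copies_def)
  then show ?thesis
    by (rule that[of K u "\<lambda>i. y (i mod K)", OF y(2) u_def uX blocks(2,3)])
qed

lemma lp_copies_imp_sym_block:
  assumes sep: "separable_seq_space X N" and p: "1 \<le> p"
    and ex: "\<And>n e. 1 \<le> n \<Longrightarrow> 0 < e \<Longrightarrow> e < 1 \<Longrightarrow> \<exists>x\<in>X. lp_copies p n x (1 - e) (1 + e)"
  shows "sym_block_fin_rep p X N"
  unfolding sym_block_fin_rep_def
proof (intro allI impI)
  fix n :: nat and \<epsilon> :: real assume n: "1 \<le> n" and \<epsilon>: "0 < \<epsilon>"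
  then have n0: "0 < n" by simp
  \<comment> \<open>Chosen so that \<open>1 / (1 + \<epsilon>) = 1 - 2 * e\<close>, which is
    strictly below \<open>1 - e\<close> and leaves room for truncation.\<close>
  define e where "e = \<epsilon> / (1 + \<epsilon>) / 2"
  have e: "0 < e" "e < 1" "e < \<epsilon>" "1 / (1 + \<epsilon>) < 1 - e"
    using \<epsilon> by (auto simp: e_def divide_simps) (auto simp: algebra_simps add_pos_pos)
  obtain x where x: "x \<in> X" "lp_copies p n x (1 - e) (1 + e)" using ex[OF n e(1,2)] by blast
  obtain \<alpha> K u where u: "0 < K" "u = (\<lambda>k. block \<alpha> (k * K) (Suc k * K))" "\<And>k. u k \<in> X"
    "disjointly_supported n u" "\<And>j k. same_ord_dist (u j) (u k)"
    "\<And>a. 1 / (1 + \<epsilon>) * pnorm p n a \<le> N (lincomb n a u) \<and> N (lincomb n a u) \<le> (1 + e) * pnorm p n a"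
    by (rule lp_copies_imp_blocks[OF sep p n0 x e(4)], rule that, assumption+)
  have up: "N (lincomb n a u) \<le> (1 + \<epsilon>) * pnorm p n a" for a
    using u(6)[of a] mult_right_mono[of "1 + e" "1 + \<epsilon>" "pnorm p n a"] pnorm_nonneg[OF p, of n a] n e by simp
  show "\<exists>m \<alpha>. m 0 = 0 \<and> (\<forall>k<n. m k < m (Suc k)) \<and>
        (let u = (\<lambda>k. block \<alpha> (m k) (m (Suc k))) in
          (\<forall>k<n. u k \<in> X) \<and> (\<forall>j<n. \<forall>k<n. same_ord_dist (u j) (u k)) \<and>
          (\<forall>a. pnorm p n a / (1 + \<epsilon>) \<le> N (lincomb n a u) \<and> N (lincomb n a u) \<le> (1 + \<epsilon>) * pnorm p n a))"
    using u(1,3,5,6) up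
    by (intro exI[of _ "\<lambda>k. k * K"] exI[of _ \<alpha>]) (simp add: Let_def u(2)[symmetric] del: mult_Suc)
qed

lemma lp_copies_imp_crude:
  assumes sep: "separable_seq_space X N" and p: "1 \<le> p" and C: "0 < C"
    and ex: "\<And>n. 1 \<le> n \<Longrightarrow> \<exists>x\<in>X. lp_copies p n x (1 / C) C"
  shows "crude_sym_fin_rep p X N"
  unfolding crude_sym_fin_rep_def
proof (intro exI[of _ "2 * C"] conjI allI impI)
  show "0 < 2 * C" using C by simp
  fix n :: nat assume n: "1 \<le> n"
  then have n0: "0 < n" by simp
  obtain x where x: "x \<in> X" "lp_copies p n x (1 / C) C" using ex[OF n] by blast
  have lt: "1 / (2 * C) < 1 / C" using C by (simp add: divide_simps)
  obtain \<alpha> K u where u: "0 < K" "u = (\<lambda>k. block \<alpha> (k * K) (Suc k * K))" "\<And>k. u k \<in> X" "disjointly_supported n u" "\<And>j k. same_ord_dist (u j) (u k)"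
    "\<And>a. 1 / (2 * C) * pnorm p n a \<le> N (lincomb n a u) \<and> N (lincomb n a u) \<le> C * pnorm p n a"
    by (rule lp_copies_imp_blocks[OF sep p n0 x lt], rule that, assumption+)
  have up: "N (lincomb n a u) \<le> 2 * C * pnorm p n a" for a
    using u(6)[of a] mult_right_mono[of C "2 * C" "pnorm p n a"] pnorm_nonneg[OF p n0, of a] C by linarith
  show "\<exists>x. (\<forall>k<n. x k \<in> X) \<and> disjointly_supported n x \<and> (\<forall>j<n. \<forall>k<n. same_ord_dist (x j) (x k)) \<and>
     (\<forall>a. pnorm p n a / (2 * C) \<le> N (lincomb n a x) \<and> N (lincomb n a x) \<le> 2 * C * pnorm p n a)"
    using u(3-6) up by (intro exI[of _ u]) auto
qed

end

section \<open>The implications from (a) to (b) and from (b) to (c)\<close>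

lemma sym_block_imp_sym:
  assumes "sym_block_fin_rep p X N" shows "sym_fin_rep p X N"
  unfolding sym_fin_rep_def
proof (intro allI impI)
  fix n :: nat and \<epsilon> :: real assume n: "1 \<le> n" and \<epsilon>: "0 < \<epsilon>"
  obtain m \<alpha> where m: "m 0 = 0" "\<forall>k<n. m k < m (Suc k)"
    and u: "let u = (\<lambda>k. block \<alpha> (m k) (m (Suc k))) in
          (\<forall>k<n. u k \<in> X) \<and> (\<forall>j<n. \<forall>k<n. same_ord_dist (u j) (u k)) \<and>
          (\<forall>a. pnorm p n a / (1 + \<epsilon>) \<le> N (lincomb n a u) \<and> N (lincomb n a u) \<le> (1 + \<epsilon>) * pnorm p n a)"
    using assms n \<epsilon> unfolding sym_block_fin_rep_def by blast
  have mono: "m j \<le> m k" if "j \<le> k" "k \<le> n" for j k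
    using that
  proof (induction rule: dec_induct)
    case (step l)
    then have "m l \<le> m (Suc l)" using m(2) by (intro less_imp_le) auto
    then show ?case using step by linarith
  qed simp
  have "disjointly_supported n (\<lambda>k. block \<alpha> (m k) (m (Suc k)))"
    unfolding disjointly_supported_def
  proof (intro allI impI)
    fix j k i assume "j < n" "k < n" "j \<noteq> k"
    then have "m (Suc j) \<le> m k \<or> m (Suc k) \<le> m j"
      using mono[of "Suc j" k] mono[of "Suc k" j] by linarith
    then show "block \<alpha> (m j) (m (Suc j)) i = 0 \<or> block \<alpha> (m k) (m (Suc k)) i = 0"
      by (auto simp: block_def)
  qed
  then show "\<exists>x. (\<forall>k<n. x k \<in> X) \<and> disjointly_supported n x \<and> (\<forall>j<n. \<forall>k<n. same_ord_dist (x j) (x k)) \<and>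
     (\<forall>a. pnorm p n a / (1 + \<epsilon>) \<le> N (lincomb n a x) \<and> N (lincomb n a x) \<le> (1 + \<epsilon>) * pnorm p n a)"
    using u[unfolded Let_def]
    by (intro exI[of _ "\<lambda>k. block \<alpha> (m k) (m (Suc k))"]) (elim conjE, intro conjI; assumption)
qed

lemma sym_imp_crude:
  assumes "sym_fin_rep p X N" shows "crude_sym_fin_rep p X N"
  unfolding crude_sym_fin_rep_def
proof (intro exI[of _ 2] conjI allI impI)
  fix n :: nat assume n: "1 \<le> n"
  show "\<exists>x. (\<forall>k<n. x k \<in> X) \<and> disjointly_supported n x \<and> (\<forall>j<n. \<forall>k<n. same_ord_dist (x j) (x k)) \<and>
     (\<forall>a. pnorm p n a / 2 \<le> N (lincomb n a x) \<and> N (lincomb n a x) \<le> 2 * pnorm p n a)"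
    by (rule mp[OF spec[OF mp[OF spec[OF assms[unfolded sym_fin_rep_def], of n] n], of "1::real"] zero_less_one,
          unfolded one_add_one])
qed simp


section \<open>Copies along the binary tree\<close>

text \<open>\<open>node q k\<close> is node \<open>k\<close> of the subtree rooted at \<open>2 ^ Suc q + 1\<close>, nodes being numbered from 1. The proper
  ancestors of a root are powers of two, hence no root lies below another one.\<close>

fun node :: "nat \<Rightarrow> nat \<Rightarrow> nat" where
  "node q k = (if k \<le> 1 then 2 ^ Suc q + 1 else 2 * node q (k div 2) + k mod 2)"

declare node.simps [simp del]

lemma node_root: "k \<le> 1 \<Longrightarrow> node q k = 2 ^ Suc q + 1"
  by (simp add: node.simps)

lemma node_child: "1 \<le> k \<Longrightarrow> b < 2 \<Longrightarrow> node q (2 * k + b) = 2 * node q k + b"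
  by (subst node.simps) auto

lemma node_step: "2 \<le> k \<Longrightarrow> node q k = 2 * node q (k div 2) + k mod 2"
  by (subst node.simps) auto

lemma node_div_2: "2 \<le> k \<Longrightarrow> node q k div 2 = node q (k div 2)"
  by (simp add: node_step[of k])

lemma node_gt_1: "1 < node q k"
proof (induction k rule: less_induct)
  case (less k)
  show ?case
  proof (cases "k \<le> 1")
    case False
    then show ?thesis using node_step[of k q] less[of "k div 2"] by linarith
  qed (simp add: node_root)
qed

text \<open>Halving leads from any node of a subtree to its root and turns a power of two greater
  than 1 into a power of two. The root is odd and greater than 1, so it is not a power of
  two.\<close>

lemma node_ne_power: "node q k \<noteq> 2 ^ i"
proof (induction k arbitrary: i rule: less_induct)
  case (less k)
  show ?case
  proof (cases i)
    case 0 then show ?thesis using node_gt_1[of q k] by simp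
  next
    case (Suc j)
    show ?thesis
    proof (cases "k \<le> 1")
      case True
      have "odd (node q k)" using True by (simp add: node_root)
      moreover have "even ((2::nat) ^ i)" using Suc by simp
      ultimately show ?thesis by metis
    next
      case False
      then show ?thesis using less[of "k div 2" j] node_div_2[of k q] Suc by auto
    qed
  qed
qed

text \<open>Halve both numbers until one of them is a root. If the other is not, half of that root,
  a power of two, would be a node, against \<open>node_ne_power\<close>. Two equal roots have equal
  \<open>q\<close>, and the remainders recover \<open>k\<close>.\<close>

lemma node_inj: "1 \<le> k \<Longrightarrow> 1 \<le> l \<Longrightarrow> node q k = node r l \<Longrightarrow> k = l \<and> q = r"
proof (induction k arbitrary: l rule: less_induct)
  case (less k)
  consider "k = 1" "l = 1" | "k = 1" "2 \<le> l" | "2 \<le> k" "l = 1" | "2 \<le> k" "2 \<le> l"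
    using less.prems by linarith
  then show ?case
  proof cases
    case 1 then show ?thesis using less.prems(3) by (simp add: node_root)
  next
    case 2
    then have "2 ^ q = node r (l div 2)" using less.prems(3) node_div_2[of l r] by (simp add: node_root)
    then show ?thesis using node_ne_power by metis
  next
    case 3
    then have "2 ^ r = node q (k div 2)" using less.prems(3) node_div_2[of k q] by (simp add: node_root)
    then show ?thesis using node_ne_power by metis
  next
    case 4
    then have "node q (k div 2) = node r (l div 2)" "k mod 2 = l mod 2"
      using less.prems(3) node_div_2[of k q] node_div_2[of l r] node_step[of k q] node_step[of l r]
      by (metis, metis mod_mult_self4 mod_mod_trivial)
    then have "k div 2 = l div 2 \<and> q = r" using less.IH[of "k div 2" "l div 2"] 4 by auto
    then show ?thesis using \<open>k mod 2 = l mod 2\<close> by (metis div_mult_mod_eq)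
  qed
qed

text \<open>The choice is unique by \<open>node_inj\<close>; \<open>Suc i\<close> converts from indices starting at 0 to node numbers.\<close>

definition plant :: "(nat \<Rightarrow> real) \<Rightarrow> (nat \<Rightarrow> real) \<Rightarrow> nat \<Rightarrow> real" where
  "plant a x i = (if \<exists>q k. 1 \<le> k \<and> Suc i = node q k
     then (case SOME (q, k). 1 \<le> k \<and> Suc i = node q k of (q, k) \<Rightarrow> a k * x q) else 0)"

lemma plant_node:
  assumes "1 \<le> k" "Suc i = node q k" shows "plant a x i = a k * x q"
proof -
  have "(SOME (q, k). 1 \<le> k \<and> Suc i = node q k) = (q, k)"
    by (rule some_equality) (use assms node_inj in auto)
  then show ?thesis using assms by (auto simp: plant_def)
qed

lemma plant_off: "(\<And>q k. 1 \<le> k \<Longrightarrow> Suc i \<noteq> node q k) \<Longrightarrow> plant a x i = 0"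
  by (auto simp: plant_def)

lemma plant_cases:
  obtains q k where "1 \<le> k" "Suc i = node q k" | "\<And>q k. 1 \<le> k \<Longrightarrow> Suc i \<noteq> node q k"
  by blast

text \<open>For \<open>k\<close> at least 2, the parent of node \<open>k\<close> is node
  \<open>k div 2\<close>. The parent of a root is a power of two, outside all subtrees, so
  \<open>Dop\<close> puts 0 at the root, in agreement with \<open>a (1 div 2) = a 0 = 0\<close>.
  Children of nodes are nodes, so no value leaves the subtrees.\<close>

lemma Dop_plant:
  assumes "a 0 = 0"
  shows "Dop (plant a x) = plant (\<lambda>k. a (k div 2)) x"
proof
  fix i
  define j where "j = Suc i div 2 - 1"
  have D: "Dop (plant a x) i = (if i = 0 then 0 else plant a x j)" by (simp add: Dop_def j_def)
  have j: "Suc j = Suc i div 2" if "i \<noteq> 0" using that by (simp add: j_def)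
  show "Dop (plant a x) i = plant (\<lambda>k. a (k div 2)) x i"
  proof (cases i rule: plant_cases)
    case (1 q k)
    then have i: "i \<noteq> 0" using node_gt_1[of q k] by auto
    show ?thesis
    proof (cases "k = 1")
      case True
      then have "Suc j = 2 ^ q" using j[OF i] 1 by (simp add: node_root)
      then have "plant a x j = 0" by (intro plant_off) (metis node_ne_power)
      then show ?thesis using D i plant_node[OF 1] True assms by simp
    next
      case False
      then have "Suc j = node q (k div 2)" using j[OF i] 1 node_div_2[of k q] by simp
      then show ?thesis using D i plant_node[OF 1] plant_node[of "k div 2" j q a x] False 1(1) by simp
    qed
  next
    case 2
    have "plant a x j = 0" if i: "i \<noteq> 0"
    proof (rule plant_off)
      fix q k :: nat assume k: "1 \<le> k"
      have "Suc i = 2 * Suc j + Suc i mod 2" using j[OF i] by simp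
      moreover have "2 * node q k + Suc i mod 2 = node q (2 * k + Suc i mod 2)"
        using node_child[OF k, of "Suc i mod 2" q] by simp
      ultimately show "Suc j \<noteq> node q k" using 2[of "2 * k + Suc i mod 2" q] k by auto
    qed
    then show ?thesis using D plant_off[OF 2] by simp
  qed
qed

lemma plant_diff: "plant (\<lambda>k. a k - c * b k) x i = plant a x i - c * plant b x i"
  by (cases i rule: plant_cases) (simp_all add: plant_node plant_off algebra_simps)

context symm_space
begin

text \<open>Planting puts the entries of \<open>tens a x\<close> at other positions, by
  \<open>node_inj\<close> without collisions. The condition \<open>a 0 = 0\<close> matches the
  numbering of nodes from 1.\<close>

lemma plant_mem_and_norm:
  assumes a: "finite {k. a k \<noteq> 0}" "a 0 = 0" and x: "x \<in> X"
  shows "plant a x \<in> X" "N (plant a x) = N (tens a x)"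
proof -
  have T: "tens a x \<in> X" by (rule tens_mem[OF a(1) x])
  have "\<exists>k q. 1 \<le> k \<and> Suc i = node q k" if "plant a x i \<noteq> 0" for i
    using that plant_off[of i a x] by blast
  then obtain \<kappa> \<theta> where \<kappa>: "\<And>i. plant a x i \<noteq> 0 \<Longrightarrow> 1 \<le> \<kappa> i \<and> Suc i = node (\<theta> i) (\<kappa> i)"
    by metis
  have inj: "inj_on (\<lambda>i. prod_encode (\<kappa> i, \<theta> i)) {i. plant a x i \<noteq> 0}"
  proof (rule inj_onI)
    fix i j assume ij: "i \<in> {i. plant a x i \<noteq> 0}" "j \<in> {i. plant a x i \<noteq> 0}"
      "prod_encode (\<kappa> i, \<theta> i) = prod_encode (\<kappa> j, \<theta> j)"
    then have "Suc i = Suc j" using \<kappa>[of i] \<kappa>[of j] by simp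
    then show "i = j" by simp
  qed
  have le: "\<bar>plant a x i\<bar> \<le> \<bar>tens a x (prod_encode (\<kappa> i, \<theta> i))\<bar>" if "plant a x i \<noteq> 0" for i
    using \<kappa>[OF that] plant_node[of "\<kappa> i" i "\<theta> i" a x] by (simp add: tens_def)
  note P = rearrange_dominated[OF T inj le]
  show "plant a x \<in> X" by (rule P(1))
  let ?g = "\<lambda>i. node (snd (prod_decode i)) (fst (prod_decode i)) - 1"
  have g: "1 \<le> fst (prod_decode i) \<and> Suc (?g i) = node (snd (prod_decode i)) (fst (prod_decode i))"
    if "tens a x i \<noteq> 0" for i
  proof -
    have "fst (prod_decode i) \<noteq> 0" using that a(2) by (metis mult_zero_left tens_def)
    then show ?thesis using node_gt_1[of "snd (prod_decode i)" "fst (prod_decode i)"] by simp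
  qed
  have "N (tens a x) \<le> N (plant a x)"
  proof (rule rearrange_dominated(2)[OF P(1), of ?g])
    show "inj_on ?g {i. tens a x i \<noteq> 0}"
    proof (rule inj_onI)
      fix i j assume ij: "i \<in> {i. tens a x i \<noteq> 0}" "j \<in> {i. tens a x i \<noteq> 0}" "?g i = ?g j"
      then have nz: "tens a x i \<noteq> 0" "tens a x j \<noteq> 0" by simp_all
      have "node (snd (prod_decode i)) (fst (prod_decode i)) = node (snd (prod_decode j)) (fst (prod_decode j))"
        by (rule trans[OF g[OF nz(1), THEN conjunct2, symmetric]
              trans[OF arg_cong[OF ij(3), of Suc] g[OF nz(2), THEN conjunct2]]])
      then have "prod_decode i = prod_decode j"
        using node_inj g[OF nz(1)] g[OF nz(2)] by (meson prod_eqI)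
      then show "i = j" by (metis prod_decode_inverse)
    qed
    fix i assume "tens a x i \<noteq> 0"
    then show "\<bar>tens a x i\<bar> \<le> \<bar>plant a x (?g i)\<bar>"
      using plant_node[of _ "?g i" _ a x] g[of i] by (simp add: tens_def)
  qed
  then show "N (plant a x) = N (tens a x)" using P(2) by simp
qed

lemma approx_eigenvalueI:
  assumes "\<And>e. 0 < e \<Longrightarrow> \<exists>w\<in>X. 0 < N w \<and> N (\<lambda>k. Dop w k - l * w k) \<le> e * N w"
  shows "approx_eigenvalue Dop l X N"
proof -
  have "\<exists>u. u \<in> X \<and> N u = 1 \<and> N (\<lambda>k. Dop u k - l * u k) \<le> inverse (real (Suc n))" for n
  proof -
    obtain w where w: "w \<in> X" "0 < N w" "N (\<lambda>k. Dop w k - l * w k) \<le> inverse (real (Suc n)) * N w"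
      using assms[of "inverse (real (Suc n))"] by auto
    define u where "u k = (1 / N w) * w k" for k
    have u: "u \<in> X" "N u = 1"
      using scale_mem[OF w(1), of "1 / N w"] N_scale[OF w(1), of "1 / N w"] w(2)
      by (auto simp: u_def[abs_def])
    have W: "(\<lambda>k. Dop w k - l * w k) \<in> X" by (intro diff_mem scale_mem Dop_mem w)
    have eq: "(\<lambda>k. Dop u k - l * u k) = (\<lambda>k. (1 / N w) * (Dop w k - l * w k))"
      by (auto simp: u_def Dop_def algebra_simps)
    have "N (\<lambda>k. Dop u k - l * u k) \<le> inverse (real (Suc n))"
      unfolding eq N_scale[OF W] using w by (simp add: divide_simps)
    then show ?thesis using u by blast
  qed
  then obtain u where u: "\<And>n. u n \<in> X" "\<And>n. N (u n) = 1"
    "\<And>n. N (\<lambda>k. Dop (u n) k - l * u n k) \<le> inverse (real (Suc n))"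
    by metis
  have "(\<lambda>n. N (\<lambda>k. Dop (u n) k - l * u n k)) \<longlonglongrightarrow> 0"
  proof (rule tendsto_sandwich[OF _ _ tendsto_const LIMSEQ_inverse_real_of_nat])
    show "\<forall>\<^sub>F n in sequentially. 0 \<le> N (\<lambda>k. Dop (u n) k - l * u n k)"
      by (intro always_eventually allI N_nonneg diff_mem scale_mem Dop_mem u)
    show "\<forall>\<^sub>F n in sequentially. N (\<lambda>k. Dop (u n) k - l * u n k) \<le> inverse (real (Suc n))"
      by (intro always_eventually allI u)
  qed
  then show ?thesis using u unfolding approx_eigenvalue_def by blast
qed

end

section \<open>Approximate eigenvectors for the p-norm, supported on finitely many levels of the
  tree\<close>

lemma floor_log_level: "2 ^ J \<le> k \<Longrightarrow> k < 2 ^ Suc J \<Longrightarrow> floor_log k = J"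
  by (rule floor_log_eqI) (auto intro: less_le_trans[of 0 "2 ^ J"])

text \<open>Level \<open>j\<close> consists of \<open>2 ^ j\<close> nodes of weight
  \<open>2 powr - real j\<close> and so contributes 1.\<close>

lemma sum_floor_log_levels:
  "(\<Sum>k = 1..<2 ^ J. 2 powr - real (floor_log k)) = real J"
proof (induction J)
  case 0 then show ?case by simp
next
  case (Suc J)
  have "(\<Sum>k = 2 ^ J..<2 ^ Suc J. 2 powr - real (floor_log k)) = (\<Sum>k::nat = 2 ^ J..<2 ^ Suc J. 2 powr - real J)"
    by (rule sum.cong) (auto simp: floor_log_level)
  also have "\<dots> = 1" by (simp add: powr_minus powr_realpow)
  finally show ?case
    using Suc sum.atLeastLessThan_concat[of 1 "2 ^ J" "2 ^ Suc J" "\<lambda>k. 2 powr - real (floor_log k)"] by simp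
qed

text \<open>The vector is constant on each level below \<open>J\<close> and decays by the factor
  \<open>l\<close> from one level to the next, so the eigenvalue equation holds there except at the
  root. The root and level \<open>J\<close> contribute 2 each to the p-th power of the error,
  against \<open>J\<close> for the vector. Vanishing for \<open>n <= 2 * k + 1\<close> keeps the
  shifted vector \<open>a (k div 2)\<close> below index \<open>n\<close> as well.\<close>

lemma lp_approx_eigenvector_finite:
  assumes p: "p \<noteq> \<infinity>" "1 \<le> real_of_ereal p" and e: "0 < e"
  obtains a n where "1 \<le> n" "a 0 = 0" "\<And>k. n \<le> 2 * k + 1 \<Longrightarrow> a k = 0" "0 < pnorm p n a"
    "pnorm p n (\<lambda>k. a (k div 2) - two_pow_inv p * a k) \<le> e * pnorm p n a"
proof -
  define P where "P = real_of_ereal p"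
  have P: "1 \<le> P" using p by (simp add: P_def)
  define l where "l = (2::real) powr (1 / P)"
  obtain J where J: "4 / e powr P < real J" using reals_Archimedean2 by blast
  have J0: "0 < J" using J e by (metis divide_pos_pos less_trans of_nat_0_less_iff powr_gt_zero zero_less_numeral less_irrefl)
  have J2: "(2::nat) \<le> 2 ^ J" using power_increasing[of 1 J "2::nat"] J0 by simp
  define n :: nat where "n = 2 ^ Suc J"
  define a where "a k = (if 1 \<le> k \<and> k < 2 ^ J then 2 powr (- real (floor_log k) / P) else 0)" for k
  define d where "d k = a (k div 2) - l * a k" for k
  have ap: "\<bar>a k\<bar> powr P = (if 1 \<le> k \<and> k < 2 ^ J then 2 powr - real (floor_log k) else 0)" for k
    using P by (simp add: a_def powr_powr)
  have "(\<Sum>k<n. \<bar>a k\<bar> powr P) = (\<Sum>k = 1..<2 ^ J. 2 powr - real (floor_log k))"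
    by (rule sum.mono_neutral_cong_right) (auto simp: ap n_def)
  then have Sa: "(\<Sum>k<n. \<bar>a k\<bar> powr P) = J" using sum_floor_log_levels by simp
  have dp: "\<bar>d k\<bar> powr P \<le> (if k = 1 then 2 else 0) + (if 2 ^ J \<le> k then 2 powr (1 - real J) else 0)"
    if k: "k < n" for k
  proof -
    consider "k = 0" | "k = 1" | "2 \<le> k" "k < 2 ^ J" | "2 \<le> k" "2 ^ J \<le> k" by linarith
    then show ?thesis
    proof cases
      case 1 then show ?thesis by (simp add: d_def a_def)
    next
      case 2
      then have "d k = - l" using J2 by (simp add: d_def a_def)
      moreover have "l powr P = 2" using P by (simp add: l_def powr_powr)
      ultimately show ?thesis using 2 by (simp add: l_def)
    next
      case 3
      have "real (floor_log k) = 1 + real (floor_log (k div 2))" using floor_log_rec[OF 3(1)] by (simp del: floor_log_half)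
      moreover have "1 \<le> k div 2" "k div 2 < 2 ^ J" using 3 by linarith+
      ultimately have "l * a k = a (k div 2)"
        using 3 P by (simp add: a_def l_def powr_add[symmetric] add_divide_distrib[symmetric] del: floor_log_half)
      then show ?thesis by (simp add: d_def)
    next
      case 4
      have kJ: "2 ^ (J - 1) \<le> k div 2" "k div 2 < 2 ^ J"
        using 4 k J0 by (auto simp: n_def power_eq_if less_mult_imp_div_less)
      then have "floor_log (k div 2) = J - 1" using floor_log_level[of "J - 1" "k div 2"] J0 by simp
      then have "\<bar>d k\<bar> powr P = 2 powr (1 - real J)"
        using 4 kJ J0 ap[of "k div 2"] div_le_mono[OF 4(1), of 2] by (simp add: d_def a_def of_nat_diff)
      then show ?thesis using 4 by simp
    qed
  qed
  have "(\<Sum>k<n. \<bar>d k\<bar> powr P) \<le>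
      (\<Sum>k<n. (if k = 1 then 2 else 0) + (if 2 ^ J \<le> k then 2 powr (1 - real J) else 0))"
    by (rule sum_mono) (use dp in auto)
  also have "\<dots> = (\<Sum>k<n. if k = 1 then 2 else 0) + (\<Sum>k<n. if 2 ^ J \<le> k then 2 powr (1 - real J) else 0)"
    by (rule sum.distrib)
  also have "(\<Sum>k<n. if k = 1 then 2 else 0) \<le> (2::real)" by simp
  also have "(\<Sum>k<n. if 2 ^ J \<le> k then 2 powr (1 - real J) else 0) = (\<Sum>k = 2 ^ J..<n. 2 powr (1 - real J))"
    by (rule sum.mono_neutral_cong_right) auto
  also have "\<dots> = 2"
    by (simp add: n_def powr_diff powr_realpow)
  finally have Sd: "(\<Sum>k<n. \<bar>d k\<bar> powr P) \<le> 4" by simp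
  have "(\<Sum>k<n. \<bar>d k\<bar> powr P) \<le> e powr P * J"
    using Sd J e by (simp add: divide_simps mult.commute)
  then have "(\<Sum>k<n. \<bar>d k\<bar> powr P) powr (1 / P) \<le> (e powr P * J) powr (1 / P)"
    using P by (intro powr_mono2) (auto simp: sum_nonneg)
  also have "\<dots> = e * real J powr (1 / P)" using P e by (simp add: powr_mult powr_powr)
  finally have le: "pnorm p n d \<le> e * pnorm p n a" using p Sa by (simp add: pnorm_finite P_def)
  have "0 < pnorm p n a" using p Sa J0 by (simp add: pnorm_finite P_def)
  moreover have "a k = 0" if "n \<le> 2 * k + 1" for k
  proof -
    have "2 ^ J \<le> k" using that by (simp add: n_def)
    then show ?thesis by (simp add: a_def)
  qed
  moreover have "d = (\<lambda>k. a (k div 2) - two_pow_inv p * a k)"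
    using p by (auto simp: d_def two_pow_inv_def l_def P_def)
  ultimately show ?thesis using that[of n a] le by (simp add: n_def a_def)
qed

text \<open>The coordinates of the vector are a tent function of the level: it must vanish at the root, where \<open>D\<close>
  inserts a zero, and decay slowly.\<close>

lemma lp_approx_eigenvector_infinite:
  assumes e: "0 < e"
  obtains a n where "1 \<le> n" "a 0 = 0" "\<And>k. n \<le> 2 * k + 1 \<Longrightarrow> a k = 0" "0 < pnorm \<infinity> n a"
    "pnorm \<infinity> n (\<lambda>k. a (k div 2) - two_pow_inv \<infinity> * a k) \<le> e * pnorm \<infinity> n a"
proof -
  obtain J where J: "1 / e < real J" using reals_Archimedean2 by blast
  have J0: "0 < J" using J e by (metis divide_pos_pos less_trans of_nat_0_less_iff zero_less_one less_irrefl)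
  \<comment> \<open>The tent lives on levels 1 to \<open>2 * J - 1\<close>, so the indices below
    \<open>n\<close> include all children of its support. Its slope \<open>1 / J\<close> is below
    \<open>e\<close>.\<close>
  define n :: nat where "n = 2 ^ (2 * J + 1)"
  define c where "c j = max 0 (1 - \<bar>real j - real J\<bar> / J)" for j :: nat
  define a where "a k = (if k = 0 then 0 else c (floor_log k))" for k
  have c0: "c 0 = 0" using J0 by (simp add: c_def)
  have cz: "c j = 0" if "2 * J \<le> j" for j using that J0 by (simp add: c_def divide_simps)
  have cd: "\<bar>c j - c (Suc j)\<bar> \<le> 1 / J" for j
  proof -
    have "\<bar>c j - c (Suc j)\<bar> \<le> \<bar>\<bar>real (Suc j) - real J\<bar> / J - \<bar>real j - real J\<bar> / J\<bar>"
      unfolding c_def by linarith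
    also have "\<dots> = \<bar>\<bar>real (Suc j) - real J\<bar> - \<bar>real j - real J\<bar>\<bar> / J"
      using J0 by (simp add: diff_divide_distrib[symmetric] abs_divide)
    also have "\<dots> \<le> 1 / J" by (rule divide_right_mono) auto
    finally show ?thesis .
  qed
  have d: "\<bar>a (k div 2) - a k\<bar> \<le> 1 / J" for k
  proof -
    consider "k = 0" | "k = 1" | "2 \<le> k" by linarith
    then show ?thesis
    proof cases
      case 3
      then show ?thesis using cd[of "floor_log (k div 2)"] floor_log_rec[OF 3] div_le_mono[OF 3, of 2]
        by (simp add: a_def del: floor_log_half)
    qed (auto simp: a_def c0)
  qed
  have n: "1 \<le> n" by (simp add: n_def)
  have "(2::nat) ^ J < n" unfolding n_def by (rule power_strict_increasing) auto
  then have a1: "1 \<le> pnorm \<infinity> n a"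
    using pnorm_ge_coord[of \<infinity> "2 ^ J" n a] by (simp add: a_def c_def)
  have "pnorm \<infinity> n (\<lambda>k. a (k div 2) - two_pow_inv \<infinity> * a k) \<le> 1 / J"
    unfolding pnorm_def using n d by (subst if_P) (auto simp: two_pow_inv_def lessThan_empty_iff intro!: Max.boundedI)
  also have "1 / J \<le> e" using J e J0 by (simp add: divide_simps mult.commute)
  also have "e \<le> e * pnorm \<infinity> n a" using a1 e by simp
  finally have le: "pnorm \<infinity> n (\<lambda>k. a (k div 2) - two_pow_inv \<infinity> * a k) \<le> e * pnorm \<infinity> n a" .
  have "a k = 0" if "n \<le> 2 * k + 1" for k
  proof -
    have k: "2 ^ (2 * J) \<le> k" using that by (simp add: n_def)
    then have "2 * J \<le> floor_log k" using floor_log_le_iff[OF k] by simp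
    then show ?thesis using cz by (simp add: a_def)
  qed
  then show ?thesis using that[of n a] n a1 le by (simp add: a_def)
qed

lemma lp_approx_eigenvector:
  assumes p: "1 \<le> p" and e: "0 < e"
  obtains a n where "1 \<le> n" "a 0 = 0" "\<And>k. n \<le> 2 * k + 1 \<Longrightarrow> a k = 0" "0 < pnorm p n a"
    "pnorm p n (\<lambda>k. a (k div 2) - two_pow_inv p * a k) \<le> e * pnorm p n a"
  using p
proof (cases rule: ereal_ge_1_cases)
  case 1
  show ?thesis unfolding 1
    by (rule lp_approx_eigenvector_infinite[OF e], rule that[unfolded 1], assumption+)
next
  case 2
  show ?thesis by (rule lp_approx_eigenvector_finite[OF 2 e], rule that, assumption+)
qed

section \<open>Transfer of the eigenvector from the p-norm to \<open>X\<close>\<close>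

context symm_space
begin

text \<open>On the planted vector \<open>w\<close>, \<open>Dop\<close> acts on the coefficients
  alone. The two bounds of \<open>lp_copies\<close> then control the error from above and
  \<open>N w\<close> from below.\<close>

lemma lp_copies_imp_approx_eigenvalue:
  assumes p: "1 \<le> p" and C: "0 < C"
    and ex: "\<And>n. 1 \<le> n \<Longrightarrow> \<exists>x\<in>X. lp_copies p n x (1 / C) C"
  shows "approx_eigenvalue Dop (two_pow_inv p) X N"
proof (rule approx_eigenvalueI)
  fix e :: real assume e: "0 < e"
  \<comment> \<open>One factor \<open>C\<close> is lost in the upper estimate of the error, the
    other in the lower estimate of \<open>N w\<close>.\<close>
  then have e': "0 < e / C\<^sup>2" using C by simp
  obtain a n where n: "1 \<le> n" and a0: "a 0 = 0" and supp: "\<And>k. n \<le> 2 * k + 1 \<Longrightarrow> a k = 0"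
    and pos: "0 < pnorm p n a"
    and le: "pnorm p n (\<lambda>k. a (k div 2) - two_pow_inv p * a k) \<le> e / C\<^sup>2 * pnorm p n a"
    by (rule lp_approx_eigenvector[OF p e'], rule that, assumption+)
  obtain x where x: "x \<in> X" "lp_copies p n x (1 / C) C" using ex[OF n] by blast
  define d where "d k = a (k div 2) - two_pow_inv p * a k" for k
  have ta: "trunc n a = a" by (rule trunc_eq) (simp add: supp)
  have td: "trunc n d = d"
  proof (rule trunc_eq)
    fix k assume "n \<le> k"
    then have "n \<le> 2 * (k div 2) + 1" "n \<le> 2 * k + 1" by linarith+
    then show "d k = 0" using supp by (simp add: d_def)
  qed
  have fa: "finite {k. a k \<noteq> 0}" using finite_trunc[of n a] ta by simp
  have fd: "finite {k. d k \<noteq> 0}" using finite_trunc[of n d] td by simp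
  define w where "w = plant a x"
  have w: "w \<in> X" "N w = N (tens a x)"
    unfolding w_def by (rule plant_mem_and_norm[OF fa a0 x(1)])+
  have "(\<lambda>k. Dop w k - two_pow_inv p * w k) = plant d x"
    unfolding w_def Dop_plant[of a, OF a0] plant_diff[symmetric] d_def ..
  then have "N (\<lambda>k. Dop w k - two_pow_inv p * w k) = N (tens d x)"
    using plant_mem_and_norm(2)[OF fd _ x(1)] a0 by (simp add: d_def[of 0])
  also have "\<dots> \<le> C * pnorm p n d" using x(2) td by (metis lp_copies_def)
  also have "\<dots> \<le> C * (e / C\<^sup>2 * pnorm p n a)"
    using le C by (intro mult_left_mono) (auto simp: d_def[abs_def])
  also have "\<dots> = e * (1 / C * pnorm p n a)" using C by (simp add: power2_eq_square)
  also have lower: "1 / C * pnorm p n a \<le> N w" using x(2) ta w(2) by (metis lp_copies_def)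
  finally have "N (\<lambda>k. Dop w k - two_pow_inv p * w k) \<le> e * N w"
    using e by simp
  moreover have "0 < 1 / C * pnorm p n a" using pos C by simp
  then have "0 < N w" using lower by linarith
  ultimately show "\<exists>w\<in>X. 0 < N w \<and> N (\<lambda>k. Dop w k - two_pow_inv p * w k) \<le> e * N w"
    using w(1) by blast
qed

end


section \<open>Improving the constant\<close>

text \<open>At time \<open>m\<close> the class \<open>l\<close> has been used \<open>K m l\<close> times. Since the \<open>K m l + 1\<close> add up to \<open>m + n\<close> and the
  \<open>\<beta> l\<close> to 1, the ratio \<open>\<beta> l / (K m l + 1)\<close> is at least \<open>1 / (m + n)\<close> for some \<open>l\<close>.\<close>

lemma greedy_allocation:
  fixes \<beta> :: "nat \<Rightarrow> real"
  assumes sum1: "(\<Sum>l<n. \<beta> l) = 1"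
  obtains e :: "nat \<Rightarrow> nat \<times> nat" where "inj e" "\<And>m. fst (e m) < n" "\<And>m. snd (e m) \<le> m"
    "\<And>m. real (snd (e m)) + 1 \<le> \<beta> (fst (e m)) * real (m + n)"
proof -
  have n: "0 < n" using sum1 by (cases n) auto
  have ex: "\<exists>l<n. real (K l) + 1 \<le> \<beta> l * real ((\<Sum>l<n. K l) + n)" for K :: "nat \<Rightarrow> nat"
  proof (rule ccontr)
    let ?s = "real ((\<Sum>l<n. K l) + n)"
    assume "\<not> ?thesis"
    then have "(\<Sum>l<n. \<beta> l * ?s) < (\<Sum>l<n. real (K l) + 1)"
      using n by (intro sum_strict_mono) (auto simp: not_le lessThan_empty_iff)
    also have "(\<Sum>l<n. \<beta> l * ?s) = ?s" using sum1 by (simp only: sum_distrib_right[symmetric] mult_1_left)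
    finally show False by (simp add: sum.distrib)
  qed
  define L where "L K = (SOME l. l < n \<and> real (K l) + 1 \<le> \<beta> l * real ((\<Sum>l<n. K l) + n))" for K
  have L: "L K < n" "real (K (L K)) + 1 \<le> \<beta> (L K) * real ((\<Sum>l<n. K l) + n)" for K
    using someI_ex[OF ex[of K]] unfolding L_def by blast+
  define K where "K = rec_nat (\<lambda>_. 0) (\<lambda>_ k. k(L k := Suc (k (L k))))"
  have K0: "K 0 = (\<lambda>_. 0)" and KS: "K (Suc m) = (K m)(L (K m) := Suc (K m (L (K m))))" for m
    by (simp_all add: K_def)
  have sumK: "(\<Sum>l<n. K m l) = m" for m
  proof (induction m)
    case 0 then show ?case by (simp add: K0)
  next
    case (Suc m)
    have "(\<Sum>l<n. K (Suc m) l) = (\<Sum>l<n. K m l + (if l = L (K m) then 1 else 0))"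
      by (rule sum.cong) (auto simp: KS)
    also have "\<dots> = (\<Sum>l<n. K m l) + 1" using L(1)[of "K m"] by (simp add: sum.distrib)
    finally show ?case using Suc by simp
  qed
  \<comment> \<open>\<open>e m\<close> records the class chosen at time \<open>m\<close> and its
    count before that choice.\<close>
  define e where "e m = (L (K m), K m (L (K m)))" for m
  have mono: "K m l \<le> K m' l" if "m \<le> m'" for m m' l
    by (rule lift_Suc_mono_le[of "\<lambda>m. K m l", OF _ that]) (simp add: KS)
  \<comment> \<open>Choosing a class raises its count for good, so a later choice of the same class
    records a larger number.\<close>
  have "inj e"
  proof (rule linorder_injI)
    fix m m' :: nat assume "m < m'"
    then show "e m \<noteq> e m'" using mono[of "Suc m" m' "L (K m)"] by (auto simp: e_def KS)
  qed
  moreover have "snd (e m) \<le> m" for m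
    using member_le_sum[of "L (K m)" "{..<n}" "K m"] sumK[of m] L(1)[of "K m"] by (simp add: e_def)
  ultimately show ?thesis
    using that[of e] L(1) L(2)[of "K m" for m] sumK by (auto simp: e_def)
qed

text \<open>Superadditivity of the power: a ratio \<open>r / s\<close> in the unit interval
  satisfies \<open>(r / s) powr P <= r / s\<close>, and the ratios \<open>(s - t) / s\<close> and
  \<open>t / s\<close> add up to 1.\<close>

lemma abs_diff_powr_le:
  fixes s t P :: real
  assumes "0 \<le> s" "0 \<le> t" "1 \<le> P"
  shows "\<bar>s - t\<bar> powr P \<le> \<bar>s powr P - t powr P\<bar>"
proof -
  have main: "(s - t) powr P + t powr P \<le> s powr P" if st: "0 \<le> t" "t \<le> s" for s t :: real
  proof (cases "s = 0")
    case True then show ?thesis using that by simp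
  next
    case False
    then have s: "0 < s" using that by simp
    have scale: "r powr P \<le> s powr P * (r / s)" if "0 \<le> r" "r \<le> s" for r
    proof -
      have "(r / s) powr P \<le> (r / s) powr 1"
        using that s assms(3) by (intro powr_mono') auto
      then have "s powr P * (r / s) powr P \<le> s powr P * (r / s)"
        using that s by (intro mult_left_mono) auto
      then show ?thesis using that s by (simp add: powr_divide)
    qed
    have "(s - t) powr P + t powr P \<le> s powr P * ((s - t) / s) + s powr P * (t / s)"
      using scale[of "s - t"] scale[of t] st by linarith
    also have "\<dots> = s powr P" using s by (simp add: diff_divide_distrib algebra_simps)
    finally show ?thesis .
  qed
  show ?thesis
  proof (cases "t \<le> s")
    case True
    then show ?thesis using main[of t s] assms by (simp add: abs_if)
  next
    case False
    then show ?thesis using main[of s t] assms by (simp add: abs_if)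
  qed
qed

text \<open>Raising \<open>n\<close> by 1 adds a telescoping sum of value at most
  \<open>1 / n\<close>, hence at most 1; for \<open>n = 1\<close> the sum vanishes.\<close>

lemma sum_inverse_shift_le:
  assumes "1 \<le> n"
  shows "(\<Sum>m<M. 1 / real (m + 1) - 1 / real (m + n)) \<le> real n"
  using assms
proof (induction n rule: dec_induct)
  case base then show ?case by simp
next
  case (step n)
  have "(\<Sum>m<M. 1 / real (m + n) - 1 / real (Suc m + n)) = 1 / real n - 1 / real (M + n)"
    using sum_lessThan_telescope'[of "\<lambda>m. 1 / real (m + n)" M] by simp
  moreover have "1 / real n \<le> 1" "0 \<le> 1 / real (M + n)" using step(1) by simp_all
  ultimately have "(\<Sum>m<M. 1 / real (m + n) - 1 / real (Suc m + n)) \<le> 1" by linarith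
  then have "(\<Sum>m<M. 1 / real (m + 1) - 1 / real (m + n)) + (\<Sum>m<M. 1 / real (m + n) - 1 / real (m + Suc n))
      \<le> real n + 1"
    using step.IH by (simp add: add.commute)
  then show ?case unfolding sum.distrib[symmetric] by (simp add: add.commute)
qed

text \<open>The \<open>p\<close>-th powers \<open>f\<close> and \<open>g\<close> of the two sequences have the same sum, so their \<open>\<ell>\<^sup>1\<close>-distance is twice the
  sum of the positive parts of \<open>g - f\<close>. This avoids any discussion of the cut-off at \<open>M\<close>.\<close>

lemma powers_l1_close:
  fixes b a :: "nat \<Rightarrow> real"
  assumes P: "1 \<le> P" and b: "\<And>l. 0 \<le> b l" "\<And>l. n \<le> l \<Longrightarrow> b l = 0" and b1: "(\<Sum>l<n. b l powr P) = 1"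
    and a: "\<And>k. a k = (if k < M then (1 / real (k + 1)) powr (1 / P) else 0)"
    and n': "prod_encode ` ({..<n} \<times> {..<M}) \<subseteq> {..<n'}"
  obtains h where "inj h" "\<And>m. m < M \<Longrightarrow> h m < n'"
    "\<forall>G. (\<forall>m. G (h m) = a m) \<longrightarrow> (\<forall>i. i \<notin> range h \<longrightarrow> G i = 0) \<longrightarrow>
       (\<Sum>i<n'. \<bar>tens b a i - G i\<bar> powr P) \<le> 2 * real n"
proof -
  obtain e where e: "inj e" "\<And>m. fst (e m) < n" "\<And>m. snd (e m) \<le> m"
    "\<And>m. real (snd (e m)) + 1 \<le> b (fst (e m)) powr P * real (m + n)"
    using greedy_allocation[OF b1] by blast
  have n: "1 \<le> n" using b1 by (cases n) auto
  define h where "h m = prod_encode (e m)" for m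
  have h: "inj h" using e(1) inj_prod_encode unfolding h_def by (simp add: inj_def)
  have hM: "h m \<in> prod_encode ` ({..<n} \<times> {..<M})" if "m < M" for m
    using e(2,3)[of m] that unfolding h_def by (intro imageI) (auto simp: mem_Times_iff)
  have a0: "0 \<le> a k" for k by (simp add: a)
  have aP: "a k powr P = (if k < M then 1 / real (k + 1) else 0)" for k
    using P by (simp add: a powr_powr)
  define f where "f i = tens b a i powr P" for i
  have f: "f (prod_encode (l, k)) = b l powr P * a k powr P" for l k
    using b(1) a0 by (simp add: f_def tens_def powr_mult)
  have f0: "0 \<le> f i" for i by (simp add: f_def)
  have F0: "0 \<le> tens b a i" for i using b(1) a0 by (simp add: tens_def)
  \<comment> \<open>Position \<open>h m\<close> is slot \<open>snd (e m)\<close> of class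
    \<open>fst (e m)\<close>. This slot lies below \<open>M\<close>, so \<open>f\<close> there is
    the p-th power of the class weight divided by \<open>snd (e m) + 1\<close>, which the greedy
    bound compares with \<open>1 / (m + n)\<close>.\<close>
  have fh: "1 / real (m + n) \<le> f (h m)" if "m < M" for m
  proof -
    have "snd (e m) < M" using e(3)[of m] that by simp
    then have fhm: "f (h m) = b (fst (e m)) powr P * (1 / real (snd (e m) + 1))"
      using f[of "fst (e m)" "snd (e m)"] by (simp add: h_def aP)
    define s where "s = real (snd (e m) + 1)"
    have s: "0 < s" by (simp add: s_def)
    have "s / real (m + n) \<le> b (fst (e m)) powr P"
      using e(4)[of m] n by (simp add: divide_le_eq s_def add.commute)
    then have "s / real (m + n) * (1 / s) \<le> f (h m)"
      unfolding fhm s_def[symmetric] using s by (intro mult_right_mono) auto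
    then show ?thesis using s by simp
  qed
  have sumf: "(\<Sum>i<n'. f i) = (\<Sum>m<M. a m powr P)"
  proof -
    have "(\<Sum>i<n'. f i) = (\<Sum>i\<in>prod_encode ` ({..<n} \<times> {..<M}). f i)"
    proof (rule sum.mono_neutral_right[OF _ n'])
      show "\<forall>i\<in>{..<n'} - prod_encode ` ({..<n} \<times> {..<M}). f i = 0"
      proof
        fix i assume i: "i \<in> {..<n'} - prod_encode ` ({..<n} \<times> {..<M})"
        obtain l k where lk: "i = prod_encode (l, k)" by (metis prod_decode_inverse surj_pair)
        then have "n \<le> l \<or> M \<le> k" using i by (metis DiffD2 SigmaI imageI lessThan_iff not_less)
        then show "f i = 0" unfolding lk f using b(2) aP by auto
      qed
    qed simp
    also have "\<dots> = (\<Sum>(l, k)\<in>{..<n} \<times> {..<M}. b l powr P * a k powr P)"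
      by (subst sum.reindex[OF inj_on_subset[OF inj_prod_encode]]) (auto simp: f intro: sum.cong)
    also have "\<dots> = (\<Sum>l<n. b l powr P) * (\<Sum>k<M. a k powr P)"
      by (simp add: sum.cartesian_product[symmetric] sum_product)
    finally show ?thesis using b1 by simp
  qed
  have main: "(\<Sum>i<n'. \<bar>tens b a i - G i\<bar> powr P) \<le> 2 * real n"
    if G: "\<And>m. G (h m) = a m" "\<And>i. i \<notin> range h \<Longrightarrow> G i = 0" for G
  proof -
    define g where "g i = G i powr P" for i
    have G0: "0 \<le> G i" for i using G a0 by (cases "i \<in> range h") auto
    have gz: "g i = 0" if "i \<notin> h ` {..<M}" for i
      using that G aP P by (cases "i \<in> range h") (auto simp: g_def a)
    have sub: "h ` {..<M} \<subseteq> {..<n'}" using hM n' by blast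
    have onh: "(\<Sum>i<n'. q i) = (\<Sum>m<M. q (h m))" if "\<And>i. i \<notin> h ` {..<M} \<Longrightarrow> q i = 0" for q :: "nat \<Rightarrow> real"
    proof -
      have "(\<Sum>i<n'. q i) = (\<Sum>i\<in>h ` {..<M}. q i)"
        by (rule sum.mono_neutral_right[OF _ sub]) (use that in auto)
      then show ?thesis by (simp add: sum.reindex[OF inj_on_subset[OF h]])
    qed
    have "(\<Sum>i<n'. \<bar>tens b a i - G i\<bar> powr P) \<le> (\<Sum>i<n'. \<bar>f i - g i\<bar>)"
      unfolding f_def g_def by (intro sum_mono abs_diff_powr_le F0 G0 P)
    also have "\<dots> = (\<Sum>i<n'. f i - g i + 2 * max 0 (g i - f i))"
      by (rule sum.cong) (auto simp: max_def)
    also have "\<dots> = (\<Sum>i<n'. f i) - (\<Sum>i<n'. g i) + 2 * (\<Sum>i<n'. max 0 (g i - f i))"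
      by (simp add: sum.distrib sum_subtractf sum_distrib_left)
    also have "(\<Sum>i<n'. g i) = (\<Sum>m<M. a m powr P)"
      using onh[OF gz] G by (simp add: g_def)
    also have "(\<Sum>i<n'. max 0 (g i - f i)) = (\<Sum>m<M. max 0 (g (h m) - f (h m)))"
      by (rule onh) (use gz f0 in auto)
    also have "\<dots> \<le> (\<Sum>m<M. 1 / real (m + 1) - 1 / real (m + n))"
    proof (rule sum_mono)
      fix m assume m: "m \<in> {..<M}"
      have "1 / real (m + n) \<le> 1 / real (m + 1)" using n by (simp add: divide_simps)
      then show "max 0 (g (h m) - f (h m)) \<le> 1 / real (m + 1) - 1 / real (m + n)"
        using fh[of m] m G(1)[of m] aP[of m] by (simp add: g_def)
    qed
    also have "\<dots> \<le> real n" by (rule sum_inverse_shift_le[OF n])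
    finally show ?thesis using sumf by simp
  qed
  show ?thesis
    by (rule that[OF h]) (use hM n' main in blast)+
qed

section \<open>From a crude constant to constants close to 1\<close>

context symm_space
begin

text \<open>Homogeneity and invariance of \<open>N\<close> under changes of sign reduce the estimate
  to nonnegative coefficients of p-norm 1; vanishing coefficients are treated apart.\<close>

lemma lp_copies_normalizedI:
  assumes p: "1 \<le> p" and n: "0 < n" and x: "x \<in> X"
    and b: "\<And>b. (\<And>l. 0 \<le> b l) \<Longrightarrow> (\<And>l. n \<le> l \<Longrightarrow> b l = 0) \<Longrightarrow> pnorm p n b = 1 \<Longrightarrow>
      c \<le> N (tens b x) \<and> N (tens b x) \<le> d"
  shows "lp_copies p n x c d"
  unfolding lp_copies_def
proof (rule allI)
  fix a :: "nat \<Rightarrow> real"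
  define r where "r = pnorm p n a"
  have r0: "0 \<le> r" unfolding r_def by (rule pnorm_nonneg[OF p n])
  have T: "tens (trunc n a) x \<in> X" by (rule tens_mem[OF finite_trunc x])
  show "c * pnorm p n a \<le> N (tens (trunc n a) x) \<and> N (tens (trunc n a) x) \<le> d * pnorm p n a"
  proof (cases "r = 0")
    case True
    have "trunc n a = (\<lambda>k. 0)"
      using pnorm_ge_coord[OF p, of _ n a] True by (auto simp: trunc_def r_def)
    then have "tens (trunc n a) x = (\<lambda>i. 0)" by (simp add: tens_def fun_eq_iff)
    then show ?thesis using True N_zero by (simp add: r_def)
  next
    case False
    then have r: "0 < r" using r0 by simp
    define b where "b l = (1 / r) * \<bar>trunc n a l\<bar>" for l
    have "pnorm p n b = (1 / r) * pnorm p n (\<lambda>l. \<bar>trunc n a l\<bar>)"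
      using pnorm_scale[OF p n, of "1 / r"] r by (simp add: b_def[abs_def])
    also have "pnorm p n (\<lambda>l. \<bar>trunc n a l\<bar>) = r"
      unfolding r_def by (rule pnorm_cong) (simp add: trunc_def)
    finally have "pnorm p n b = 1" using r by simp
    then have B: "c \<le> N (tens b x) \<and> N (tens b x) \<le> d"
      by (intro assms(4)) (use r in \<open>auto simp: b_def trunc_def\<close>)
    have fb: "finite {k. b k \<noteq> 0}"
      by (rule finite_subset[OF _ finite_trunc[of n a]]) (auto simp: b_def)
    have "N (tens (trunc n a) x) = N (\<lambda>i. r * tens b x i)"
      by (rule N_abs_cong(2)[OF scale_mem[OF tens_mem[OF fb x]]])
         (use r in \<open>auto simp: tens_def b_def abs_mult\<close>)
    also have "\<dots> = r * N (tens b x)" using N_scale[OF tens_mem[OF fb x]] r by simp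
    finally show ?thesis
      using B r by (simp add: r_def[symmetric] mult.commute)
  qed
qed

text \<open>In the p-norm, \<open>tens b a\<close> differs from a relocated copy \<open>G\<close> of
  \<open>a\<close> by at most \<open>(2 * real n) powr (1 / P)\<close>. One factor \<open>C\<close>
  turns this into a bound for \<open>N\<close>, another turns the p-norm of \<open>a\<close> into a
  lower bound for \<open>N v\<close>. For large \<open>H\<close> the difference is
  negligible.\<close>

lemma lp_copies_improve:
  assumes p: "p \<noteq> \<infinity>" "1 \<le> p" and C: "0 < C"
    and ex: "\<And>n. 1 \<le> n \<Longrightarrow> \<exists>x\<in>X. lp_copies p n x (1 / C) C"
    and n: "1 \<le> n" and e: "0 < e"
  shows "\<exists>v\<in>X. lp_copies p n v (1 - e) (1 + e)"
proof -
  define P where "P = real_of_ereal p"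
  have P: "1 \<le> P" using p(2) by (rule ereal_ge_1_cases) (use p(1) in \<open>auto simp: P_def\<close>)
  \<comment> \<open>Divergence of the harmonic series supplies \<open>M\<close>. The term
    \<open>C\<^sup>2 / e\<close> collects both losses of \<open>C\<close> and the tolerance, and the
    summand 1 makes \<open>H\<close> positive.\<close>
  have "\<forall>\<^sub>F M in sequentially. 2 * real n * (C\<^sup>2 / e) powr P + 1 \<le> (harm M :: real)"
    using harm_at_top by (simp add: filterlim_at_top)
  then obtain M where M: "2 * real n * (C\<^sup>2 / e) powr P + 1 \<le> (harm M :: real)"
    using eventually_happens'[OF trivial_limit_sequentially] by blast
  define H where "H = (\<Sum>k<M. 1 / real (k + 1))"
  have "(harm M :: real) = H"
    unfolding harm_def H_def by (simp add: sum.atLeast1_atMost_eq inverse_eq_divide add.commute)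
  moreover have "0 \<le> 2 * real n * (C\<^sup>2 / e) powr P" by simp
  ultimately have H: "2 * real n * (C\<^sup>2 / e) powr P \<le> H" "0 < H" using M by linarith+
  define a where "a k = (if k < M then (1 / real (k + 1)) powr (1 / P) else 0)" for k
  have fa: "finite {k. a k \<noteq> 0}" by (rule finite_subset[of _ "{..<M}"]) (auto simp: a_def)
  \<comment> \<open>A bound for all positions that \<open>tens b a\<close> can occupy, whatever
    \<open>b\<close> is, so that one \<open>x\<close> serves every \<open>b\<close>.\<close>
  define n' where "n' = Suc (Max (insert 0 (prod_encode ` ({..<n} \<times> {..<M}))))"
  have n': "prod_encode ` ({..<n} \<times> {..<M}) \<subseteq> {..<n'}"
    unfolding n'_def using Max_ge[of "insert 0 (prod_encode ` ({..<n} \<times> {..<M}))"] by (auto simp: less_Suc_eq_le)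
  obtain x where x: "x \<in> X" "lp_copies p n' x (1 / C) C" using ex[of n'] by (auto simp: n'_def)
  define v where "v = tens a x"
  have v: "v \<in> X" unfolding v_def by (rule tens_mem[OF fa x(1)])
  have main: "\<bar>N (tens b v) - N v\<bar> \<le> e * N v \<and> 0 < N v"
    if b: "\<And>l. 0 \<le> b l" "\<And>l. n \<le> l \<Longrightarrow> b l = 0" and b1: "pnorm p n b = 1" for b
  proof -
    have sb: "(\<Sum>l<n. b l powr P) = 1"
      using pnorm_powr[OF p(1), of n b] P b1 b(1) by (simp add: P_def)
    obtain h where h: "inj h" "\<And>m. m < M \<Longrightarrow> h m < n'"
      and close: "\<forall>G. (\<forall>m. G (h m) = a m) \<longrightarrow> (\<forall>i. i \<notin> range h \<longrightarrow> G i = 0) \<longrightarrow>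
       (\<Sum>i<n'. \<bar>tens b a i - G i\<bar> powr P) \<le> 2 * real n"
      by (rule powers_l1_close[OF P b(1) _ sb a_def n'], erule b(2), rule that, assumption+)
    \<comment> \<open>\<open>a\<close> relocated along the injection \<open>h\<close>, so that
      \<open>tens G x\<close> has the same norm as \<open>v\<close>.\<close>
    define G where "G i = (if i \<in> range h then a (inv h i) else 0)" for i
    have Gh: "G (h m) = a m" for m using h(1) by (simp add: G_def)
    have Goff: "G i = 0" if "i \<notin> range h" for i using that by (simp add: G_def)
    have Gnz: "\<exists>m<M. i = h m" if nz: "G i \<noteq> 0" for i
    proof -
      obtain m where m: "i = h m" using nz Goff by blast
      then have "a m \<noteq> 0" using nz Gh by simp
      then have "m < M" by (rule contrapos_np) (simp add: a_def)
      then show ?thesis using m by blast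
    qed
    have tG: "trunc n' G = G"
    proof (rule trunc_eq)
      fix i assume "n' \<le> i"
      then show "G i = 0" using Gnz[of i] h(2) by force
    qed
    have fG: "finite {k. G k \<noteq> 0}" using finite_trunc[of n' G] tG by simp
    have fb: "finite {k. b k \<noteq> 0}"
      by (rule finite_subset[of _ "{..<n}"]) (use b(2) not_le in \<open>auto\<close>)
    have tF: "trunc n' (tens b a) = tens b a"
    proof (rule trunc_eq)
      fix i assume i: "n' \<le> i"
      obtain l k where lk: "i = prod_encode (l, k)" by (metis prod_decode_inverse surj_pair)
      have "i < n'" if "l < n" "k < M"
        using subsetD[OF n', of i] that by (simp add: lk)
      then have "\<not> (l < n \<and> k < M)" using i by linarith
      then show "tens b a i = 0" using b(2)[of l] by (auto simp: lk tens_def a_def)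
    qed
    have fF: "finite {k. tens b a k \<noteq> 0}" using finite_trunc[of n' "tens b a"] tF by simp
    have GX: "tens G x \<in> X" and FX: "tens (tens b a) x \<in> X"
      by (rule tens_mem[OF fG x(1)], rule tens_mem[OF fF x(1)])
    have NG: "N (tens G x) = N v"
    proof (rule antisym)
      show "N (tens G x) \<le> N v"
        unfolding v_def
        by (rule N_tens_mono[OF fa x(1), of "inv h"])
           (use Goff in \<open>auto simp: G_def intro!: inj_on_subset[OF inj_on_inv_into[OF subset_refl]]\<close>)
      show "N v \<le> N (tens G x)"
        unfolding v_def
        by (rule N_tens_mono[OF fG x(1), of h]) (auto simp: Gh intro: inj_on_subset[OF h(1)])
    qed
    have NF: "N (tens b v) = N (tens (tens b a) x)"
      unfolding v_def by (rule N_tens_assoc[OF fb fa x(1)])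
    define d where "d i = tens b a i - G i" for i
    have td: "trunc n' d = d"
      unfolding d_def using fun_cong[OF tF] fun_cong[OF tG] by (auto simp: trunc_def fun_eq_iff split: if_splits) metis+
    have "(\<Sum>i<n'. \<bar>tens b a i - G i\<bar> powr P) \<le> 2 * real n"
      using spec[OF close, of G] Gh Goff by blast
    then have "pnorm p n' d \<le> (2 * real n) powr (1 / P)"
      unfolding pnorm_finite[OF p(1)] P_def[symmetric]
      using P by (intro powr_mono2) (auto simp: d_def sum_nonneg)
    moreover have "N (tens d x) \<le> C * pnorm p n' d" using x(2) td by (metis lp_copies_def)
    ultimately have up: "N (tens d x) \<le> C * (2 * real n) powr (1 / P)"
      using C by (meson mult_left_mono less_imp_le order_trans)
    have "(\<Sum>i<n'. \<bar>G i\<bar> powr P) = H"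
    proof -
      have "(\<Sum>i<n'. \<bar>G i\<bar> powr P) = (\<Sum>i\<in>h ` {..<M}. \<bar>G i\<bar> powr P)"
        by (rule sum.mono_neutral_right) (use h(2) Gnz in force)+
      also have "\<dots> = (\<Sum>m<M. \<bar>a m\<bar> powr P)"
        by (simp add: sum.reindex[OF inj_on_subset[OF h(1)]] Gh)
      also have "\<dots> = H" unfolding H_def using P by (intro sum.cong) (auto simp: a_def powr_powr)
      finally show ?thesis .
    qed
    then have "pnorm p n' G = H powr (1 / P)" by (simp add: pnorm_finite[OF p(1)] P_def)
    then have low: "1 / C * H powr (1 / P) \<le> N v"
      using x(2) tG NG by (metis lp_copies_def)
    have "(2 * real n * (C\<^sup>2 / e) powr P) powr (1 / P) \<le> H powr (1 / P)"
      using H P by (intro powr_mono2) auto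
    also have "(2 * real n * (C\<^sup>2 / e) powr P) powr (1 / P) = (2 * real n) powr (1 / P) * (C\<^sup>2 / e)"
      using P e C by (simp add: powr_mult powr_powr)
    finally have "C * (2 * real n) powr (1 / P) \<le> e * (1 / C * H powr (1 / P))"
      using C e by (simp add: field_simps power2_eq_square)
    also have "\<dots> \<le> e * N v" using low e by (intro mult_left_mono) auto
    finally have small: "N (tens d x) \<le> e * N v" using up by linarith
    have dd: "tens d x = (\<lambda>i. tens (tens b a) x i - tens G x i)"
      unfolding d_def by (rule tens_diff_left)
    have "N (tens (tens b a) x) \<le> N (tens G x) + N (tens d x)"
      using N_le_diff[OF FX GX] by (simp add: dd)
    moreover have "N (tens G x) \<le> N (tens (tens b a) x) + N (tens d x)"
    proof -
      have "N (\<lambda>i. tens G x i - tens (tens b a) x i) = N (tens d x)"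
        unfolding dd by (rule N_abs_cong(2)[OF diff_mem[OF FX GX]]) (simp add: abs_minus_commute)
      then show ?thesis using N_le_diff[OF GX FX] by simp
    qed
    moreover have "0 < 1 / C * H powr (1 / P)" using C H by simp
    ultimately show ?thesis using small low NG NF by linarith
  qed
  \<comment> \<open>A normalised coefficient vector at which \<open>main\<close> is evaluated to
    obtain \<open>0 < N v\<close>.\<close>
  define b1 where "b1 l = (if l = 0 then 1 else 0 :: real)" for l :: nat
  have "(\<Sum>k<n. \<bar>b1 k\<bar> powr P) = (\<Sum>k<n. if k = 0 then 1 else 0)"
    using P by (intro sum.cong) (auto simp: b1_def)
  then have "pnorm p n b1 = 1"
    using n by (simp add: pnorm_finite[OF p(1)] P_def)
  then have pos: "0 < N v" using main[of b1] n by (auto simp: b1_def)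
  have "lp_copies p n v ((1 - e) * N v) ((1 + e) * N v)"
  proof (rule lp_copies_normalizedI[OF p(2) _ v])
    fix b :: "nat \<Rightarrow> real" assume "\<And>l. 0 \<le> b l" "\<And>l. n \<le> l \<Longrightarrow> b l = 0" "pnorm p n b = 1"
    then have "\<bar>N (tens b v) - N v\<bar> \<le> e * N v" using main by blast
    then show "(1 - e) * N v \<le> N (tens b v) \<and> N (tens b v) \<le> (1 + e) * N v"
      by (simp add: algebra_simps abs_le_iff)
  qed (use n in simp)
  from lp_copies_scale[OF this v, of "1 / N v"]
  have "lp_copies p n (\<lambda>i. 1 / N v * v i) (1 - e) (1 + e)" using pos by simp
  then show ?thesis using scale_mem[OF v] by blast
qed

end


section \<open>Approximate eigenvectors of D\<close>

context symm_space
begin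

lemma Dop_power_mem: "x \<in> X \<Longrightarrow> (Dop ^^ m) x \<in> X"
  by (induction m) (auto intro: Dop_mem)

text \<open>The error at \<open>m + 1\<close> is \<open>Dop\<close> applied to the error at
  \<open>m\<close> plus \<open>l ^ m\<close> times the initial error. As \<open>Dop\<close> has norm
  at most 2 and \<open>l\<close> is at most 2, it is at most twice the old bound plus
  \<open>2 ^ m * \<delta>\<close>, and \<open>4 ^ m * \<delta>\<close> is a simple majorant.\<close>

lemma Dop_power_close:
  assumes u: "u \<in> X" and Nu: "N u = 1" and l: "0 \<le> l" "l \<le> 2"
    and close: "N (\<lambda>k. Dop u k - l * u k) \<le> \<delta>"
  shows "N (\<lambda>k. (Dop ^^ m) u k - l ^ m * u k) \<le> 4 ^ m * \<delta>"
proof (induction m)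
  case 0
  have "0 \<le> \<delta>" using N_nonneg[OF diff_mem[OF Dop_mem[OF u] scale_mem[OF u]], of l] close by linarith
  then show ?case by (simp add: N_zero)
next
  case (Suc m)
  let ?d = "\<lambda>k. (Dop ^^ m) u k - l ^ m * u k" and ?r = "\<lambda>k. Dop u k - l * u k"
  have d: "?d \<in> X" by (intro diff_mem Dop_power_mem scale_mem u)
  have r: "?r \<in> X" by (intro diff_mem Dop_mem scale_mem u)
  have \<delta>: "0 \<le> \<delta>" using N_nonneg[OF r] close by linarith
  have eq: "(\<lambda>k. (Dop ^^ Suc m) u k - l ^ Suc m * u k) = (\<lambda>k. Dop ?d k + l ^ m * ?r k)"
    by (auto simp: Dop_def algebra_simps)
  have "N (\<lambda>k. (Dop ^^ Suc m) u k - l ^ Suc m * u k) \<le> N (Dop ?d) + l ^ m * N ?r"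
    unfolding eq using N_triangle[OF Dop_mem[OF d] scale_mem[OF r, of "l ^ m"]] N_scale[OF r, of "l ^ m"] l(1)
    by simp
  also have "\<dots> \<le> 2 * (4 ^ m * \<delta>) + 2 ^ m * \<delta>"
  proof (rule add_mono)
    show "N (Dop ?d) \<le> 2 * (4 ^ m * \<delta>)" using N_Dop_le[OF d] Suc by linarith
    show "l ^ m * N ?r \<le> 2 ^ m * \<delta>"
      using close l N_nonneg[OF r] by (intro mult_mono power_mono) auto
  qed
  also have "(2::real) ^ m * \<delta> \<le> 4 ^ m * \<delta>" using \<delta> by (intro mult_right_mono power_mono) auto
  also have "2 * (4 ^ m * \<delta>) + 4 ^ m * \<delta> \<le> 4 ^ Suc m * \<delta>" using \<delta> by simp
  finally show ?case by simp
qed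

lemma approx_eigenvectorE:
  assumes "approx_eigenvalue Dop l X N" "0 < \<delta>"
  obtains u where "u \<in> X" "N u = 1" "N (\<lambda>k. Dop u k - l * u k) \<le> \<delta>"
proof -
  obtain u where u: "\<And>n. u n \<in> X \<and> N (u n) = 1" "(\<lambda>n. N (\<lambda>k. Dop (u n) k - l * u n k)) \<longlonglongrightarrow> 0"
    using assms(1) unfolding approx_eigenvalue_def by blast
  obtain n where "N (\<lambda>k. Dop (u n) k - l * u n k) < \<delta>"
    using eventually_happens'[OF trivial_limit_sequentially order_tendstoD(2)[OF u(2) assms(2)]] by blast
  then show ?thesis using that[of "u n"] u(1)[of n] by simp
qed

abbreviation ones :: "nat \<Rightarrow> nat \<Rightarrow> real" where
  "ones r \<equiv> (\<lambda>k. if k < r then 1 else 0)"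

lemma finite_ones: "finite {k. ones r k \<noteq> 0}"
  by (rule finite_subset[of _ "{..<r}"]) auto

lemma N_tens_ones_mono: "x \<in> X \<Longrightarrow> r \<le> s \<Longrightarrow> N (tens (ones r) x) \<le> N (tens (ones s) x)"
  by (rule N_tens_mono[OF finite_ones, of _ id]) auto

text \<open>\<open>(Dop ^^ m) u\<close> contains each entry of \<open>u\<close> once for every
  descendant \<open>m\<close> levels down, hence \<open>2 ^ m\<close> times. Dividing the node
  number by \<open>2 ^ m\<close>, the remainder names the copy and the quotient the entry.\<close>

lemma N_dsum_Dop_power:
  assumes A: "finite A" and u: "u \<in> X"
  shows "N (dsum A (\<lambda>l. (Dop ^^ c l) u)) = N (tens (ones (\<Sum>l\<in>A. 2 ^ c l)) u)"
proof -
  define r :: nat where "r = (\<Sum>l\<in>A. 2 ^ c l)"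
  let ?S = "SIGMA l:A. {..<2 ^ c l :: nat}"
  have "finite ?S" "card ?S = card {..<r}" using A by (auto simp: r_def)
  \<comment> \<open>\<open>\<iota>\<close> numbers all copies: \<open>(l, s)\<close> stands for the
    copy in summand \<open>l\<close> with remainder \<open>s\<close>.\<close>
  then obtain \<iota> where \<iota>: "bij_betw \<iota> ?S {..<r}"
    using finite_same_card_bij finite_lessThan by blast
  have injD: "\<And>s t. s \<in> ?S \<Longrightarrow> t \<in> ?S \<Longrightarrow> \<iota> s = \<iota> t \<Longrightarrow> s = t"
    using \<iota> by (auto simp: bij_betw_def dest: inj_onD)
  let ?Y = "dsum A (\<lambda>l. (Dop ^^ c l) u)" and ?Z = "tens (ones r) u"
  have Y: "?Y \<in> X" by (rule dsum_mem[OF A Dop_power_mem[OF u]])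
  have Z: "?Z \<in> X" by (rule tens_mem[OF finite_ones u])
  have "N ?Y \<le> N ?Z"
  proof -
    define g where "g i = (let (l, j) = prod_decode i in
      prod_encode (\<iota> (l, Suc j mod 2 ^ c l), Suc j div 2 ^ c l - 1))" for i
    have val: "?Y (prod_encode (l, j)) = (if l \<in> A \<and> 2 ^ c l \<le> Suc j then u (Suc j div 2 ^ c l - 1) else 0)" for l j
      by (auto simp: dsum_def Dop_power)
    have nz: "\<exists>l j. i = prod_encode (l, j) \<and> l \<in> A \<and> 2 ^ c l \<le> Suc j" if "?Y i \<noteq> 0" for i
    proof -
      obtain l j where lj: "i = prod_encode (l, j)" by (metis prod_decode_inverse surj_pair)
      then have "l \<in> A \<and> 2 ^ c l \<le> Suc j" using that val[of l j] by (metis (full_types))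
      then show ?thesis using lj by blast
    qed
    have "inj_on g {i. ?Y i \<noteq> 0}"
    proof (rule inj_onI)
      fix i i' assume "i \<in> {i. ?Y i \<noteq> 0}" "i' \<in> {i. ?Y i \<noteq> 0}" and eq: "g i = g i'"
      then obtain l j l' j' where lj: "i = prod_encode (l, j)" "l \<in> A" "2 ^ c l \<le> Suc j"
        "i' = prod_encode (l', j')" "l' \<in> A" "2 ^ c l' \<le> Suc j'"
        using nz[of i] nz[of i'] by blast
      have "(l, Suc j mod 2 ^ c l) = (l', Suc j' mod 2 ^ c l')"
        using eq lj by (intro injD) (auto simp: g_def)
      then have ll: "l = l'" "Suc j mod 2 ^ c l = Suc j' mod 2 ^ c l" by auto
      have "1 \<le> Suc j div 2 ^ c l" "1 \<le> Suc j' div 2 ^ c l"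
        using div_le_mono[OF lj(3), of "2 ^ c l"] div_le_mono[OF lj(6), of "2 ^ c l"] ll by auto
      moreover have "Suc j div 2 ^ c l - 1 = Suc j' div 2 ^ c l - 1"
        using eq lj ll by (simp add: g_def)
      ultimately have "Suc j div 2 ^ c l = Suc j' div 2 ^ c l" by linarith
      then have "Suc j = Suc j'" using ll(2) by (metis div_mult_mod_eq)
      then show "i = i'" using lj ll by simp
    qed
    moreover have "\<bar>?Y i\<bar> \<le> \<bar>?Z (g i)\<bar>" if i: "?Y i \<noteq> 0" for i
    proof -
      obtain l j where lj: "i = prod_encode (l, j)" "l \<in> A" "2 ^ c l \<le> Suc j" using nz[OF i] by blast
      have "\<iota> (l, Suc j mod 2 ^ c l) \<in> {..<r}"
        by (rule bij_betw_apply[OF \<iota>]) (use lj in auto)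
      then show ?thesis using lj val[of l j] by (simp add: g_def tens_def)
    qed
    ultimately show ?thesis by (rule rearrange_dominated(2)[OF Z])
  qed
  moreover have "N ?Z \<le> N ?Y"
  proof -
    define g where "g i = (let (k, q) = prod_decode i; (l, s) = inv_into ?S \<iota> k in
      prod_encode (l, 2 ^ c l * Suc q + s - 1))" for i
    have nz: "\<exists>l s q. i = prod_encode (\<iota> (l, s), q) \<and> (l, s) \<in> ?S \<and> ?Z i = u q
        \<and> g i = prod_encode (l, 2 ^ c l * Suc q + s - 1)" if i: "?Z i \<noteq> 0" for i
    proof -
      obtain k q where kq: "i = prod_encode (k, q)" by (metis prod_decode_inverse surj_pair)
      then have k: "k \<in> {..<r}" "?Z i = u q" using i by (auto simp: tens_def split: if_splits)
      obtain l s where ls: "inv_into ?S \<iota> k = (l, s)" by fastforce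
      have "k \<in> \<iota> ` ?S" using k(1) \<iota> by (simp add: bij_betw_def)
      then have "(l, s) \<in> ?S" "\<iota> (l, s) = k"
        using inv_into_into[of k \<iota> ?S] f_inv_into_f[of k \<iota> ?S] ls by auto
      then show ?thesis using kq k(2) ls by (intro exI[of _ l] exI[of _ s] exI[of _ q]) (auto simp: g_def)
    qed
    have arith: "Suc (2 ^ c l * Suc q + s - 1) div 2 ^ c l = Suc q"
      "Suc (2 ^ c l * Suc q + s - 1) mod 2 ^ c l = s" "2 ^ c l \<le> Suc (2 ^ c l * Suc q + s - 1)"
      if "s < 2 ^ c l" for l q s
    proof -
      have S: "Suc (2 ^ c l * Suc q + s - 1) = 2 ^ c l * Suc q + s"
        by (simp add: Suc_diff_1 del: mult_Suc_right)
      show "Suc (2 ^ c l * Suc q + s - 1) div 2 ^ c l = Suc q"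
        "Suc (2 ^ c l * Suc q + s - 1) mod 2 ^ c l = s" "2 ^ c l \<le> Suc (2 ^ c l * Suc q + s - 1)"
        unfolding S using that by (simp_all del: mult_Suc_right) simp
    qed
    have "inj_on g {i. ?Z i \<noteq> 0}"
    proof (rule inj_onI)
      fix i i' assume i: "i \<in> {i. ?Z i \<noteq> 0}" "i' \<in> {i. ?Z i \<noteq> 0}" and eq: "g i = g i'"
      obtain l s q where a: "i = prod_encode (\<iota> (l, s), q)" "s < 2 ^ c l"
        "g i = prod_encode (l, 2 ^ c l * Suc q + s - 1)"
        using nz[of i] i by blast
      obtain l' s' q' where b: "i' = prod_encode (\<iota> (l', s'), q')" "s' < 2 ^ c l'"
        "g i' = prod_encode (l', 2 ^ c l' * Suc q' + s' - 1)"
        using nz[of i'] i by blast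
      have l: "l = l'" and "2 ^ c l * Suc q + s - 1 = 2 ^ c l' * Suc q' + s' - 1"
        using eq a(3) b(3) by auto
      then have "Suc q = Suc q'" "s = s'"
        using arith(1,2)[OF a(2), of q] arith(1,2)[OF b(2), of q'] by (metis, metis)
      then show "i = i'" using a b l by simp
    qed
    moreover have "\<bar>?Z i\<bar> \<le> \<bar>?Y (g i)\<bar>" if i: "?Z i \<noteq> 0" for i
    proof -
      obtain l s q where a: "l \<in> A" "s < 2 ^ c l" "?Z i = u q" "g i = prod_encode (l, 2 ^ c l * Suc q + s - 1)"
        using nz[OF i] by blast
      have "?Y (g i) = u q"
        using arith(1,3)[OF a(2), of q] a(1) by (simp add: a(4) dsum_def Dop_power del: mult_Suc_right)
      then show ?thesis using a(3) by simp
    qed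
    ultimately show ?thesis by (rule rearrange_dominated(2)[OF Y])
  qed
  ultimately show ?thesis by (simp add: r_def)
qed

lemma N_Dop_power:
  assumes u: "u \<in> X" shows "N ((Dop ^^ m) u) = N (tens (ones (2 ^ m)) u)"
proof -
  let ?y = "(Dop ^^ m) u"
  have y: "?y \<in> X" by (rule Dop_power_mem[OF u])
  have "N (dsum {0} (\<lambda>l. ?y)) \<le> N ?y" using N_dsum_le[of "{0}" "\<lambda>l. ?y"] y by simp
  moreover have "N ?y \<le> N (dsum {0} (\<lambda>l. ?y))"
    by (rule rearrange_dominated(2)[OF dsum_mem, of _ _ "\<lambda>i. prod_encode (0, i)"])
       (auto simp: y dsum_def intro: inj_onI)
  ultimately show ?thesis using N_dsum_Dop_power[OF _ u, of "{0}" "\<lambda>_. m"] by simp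
qed

text \<open>A weight \<open>l ^ c k\<close> may be traded for \<open>2 ^ c k\<close> unweighted
  copies: the weighted vector is close to \<open>(Dop ^^ c k) u\<close>, which consists of that many
  copies. The errors of the summands add up.\<close>

lemma N_weighted_copies_close:
  assumes A: "finite A" and u: "u \<in> X" and Nu: "N u = 1" and l: "0 \<le> l" "l \<le> 2"
    and close: "N (\<lambda>k. Dop u k - l * u k) \<le> \<delta>" and c: "\<And>k. k \<in> A \<Longrightarrow> c k \<le> K"
  shows "\<bar>N (tens (\<lambda>k. if k \<in> A then l ^ c k else 0) u) - N (tens (ones (\<Sum>k\<in>A. 2 ^ c k)) u)\<bar>
    \<le> real (card A) * (4 ^ K * \<delta>)"
proof -
  let ?Y = "dsum A (\<lambda>k. (Dop ^^ c k) u)"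
  have T: "tens (\<lambda>k. if k \<in> A then l ^ c k else 0) u = dsum A (\<lambda>k i. l ^ c k * u i)"
    using tens_eq_dsum[of A "\<lambda>k. if k \<in> A then l ^ c k else 0" u] by (auto simp: dsum_def fun_eq_iff)
  have TX: "dsum A (\<lambda>k i. l ^ c k * u i) \<in> X" by (rule dsum_mem[OF A scale_mem[OF u]])
  have YX: "?Y \<in> X" by (rule dsum_mem[OF A Dop_power_mem[OF u]])
  let ?d = "\<lambda>k i. (Dop ^^ c k) u i - l ^ c k * u i"
  have dX: "?d k \<in> X" for k by (intro diff_mem Dop_power_mem scale_mem u)
  have \<delta>: "0 \<le> \<delta>" using N_nonneg[OF diff_mem[OF Dop_mem[OF u] scale_mem[OF u]], of l] close by linarith
  have "N (dsum A ?d) \<le> (\<Sum>k\<in>A. N (?d k))" by (rule N_dsum_le[OF A dX])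
  also have "\<dots> \<le> (\<Sum>k\<in>A. 4 ^ K * \<delta>)"
  proof (rule sum_mono)
    fix k assume k: "k \<in> A"
    have "N (?d k) \<le> 4 ^ c k * \<delta>" by (rule Dop_power_close[OF u Nu l close])
    also have "\<dots> \<le> 4 ^ K * \<delta>" using c[OF k] \<delta> by (intro mult_right_mono power_increasing) auto
    finally show "N (?d k) \<le> 4 ^ K * \<delta>" .
  qed
  finally have D: "N (dsum A ?d) \<le> real (card A) * (4 ^ K * \<delta>)" by simp
  have eq1: "dsum A ?d = (\<lambda>i. ?Y i - dsum A (\<lambda>k i. l ^ c k * u i) i)"
    by (auto simp: dsum_def)
  have "N ?Y \<le> N (dsum A (\<lambda>k i. l ^ c k * u i)) + N (dsum A ?d)"
    unfolding eq1 by (rule N_le_diff[OF YX TX])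
  moreover have "N (dsum A (\<lambda>k i. l ^ c k * u i)) \<le> N ?Y + N (dsum A ?d)"
  proof -
    have "N (\<lambda>i. dsum A (\<lambda>k i. l ^ c k * u i) i - ?Y i) = N (dsum A ?d)"
      unfolding eq1 by (rule N_abs_cong(2)[OF diff_mem[OF YX TX]]) (simp add: abs_minus_commute)
    then show ?thesis using N_le_diff[OF TX YX] by simp
  qed
  ultimately show ?thesis
    using D unfolding T N_dsum_Dop_power[OF A u, symmetric] by linarith
qed

lemma N_copies_close:
  assumes u: "u \<in> X" and Nu: "N u = 1" and l: "0 \<le> l" "l \<le> 2"
    and close: "N (\<lambda>k. Dop u k - l * u k) \<le> \<delta>"
  shows "\<bar>N (tens (ones (2 ^ m)) u) - l ^ m\<bar> \<le> 4 ^ m * \<delta>"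
proof -
  have y: "(Dop ^^ m) u \<in> X" and s: "(\<lambda>k. l ^ m * u k) \<in> X"
    by (rule Dop_power_mem[OF u], rule scale_mem[OF u])
  have Ns: "N (\<lambda>k. l ^ m * u k) = l ^ m" using N_scale[OF u] l Nu by simp
  have d: "N (\<lambda>k. (Dop ^^ m) u k - l ^ m * u k) \<le> 4 ^ m * \<delta>"
    by (rule Dop_power_close[OF u Nu l close])
  have "N (\<lambda>k. l ^ m * u k - (Dop ^^ m) u k) = N (\<lambda>k. (Dop ^^ m) u k - l ^ m * u k)"
    by (rule N_abs_cong(2)[OF diff_mem[OF y s]]) (simp add: abs_minus_commute)
  then show ?thesis
    using N_le_diff[OF y s] N_le_diff[OF s y] Ns d unfolding N_Dop_power[OF u] by linarith
qed

text \<open>The eigenvalue is 1, so even \<open>2 ^ n\<close> copies of \<open>u\<close> have norm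
  at most \<open>1 + e\<close>, which covers \<open>n\<close> coefficients of modulus at most 1. A
  coefficient of modulus 1 contributes a full copy of \<open>u\<close>, whence the lower
  bound.\<close>

lemma approx_eigenvalue_imp_lp_copies_infinite:
  assumes eig: "approx_eigenvalue Dop (two_pow_inv \<infinity>) X N" and n: "1 \<le> n" and e: "0 < e" "e < 1"
  shows "\<exists>x\<in>X. lp_copies \<infinity> n x (1 - e) (1 + e)"
proof -
  have "0 < e / 4 ^ n" using e by simp
  with eig obtain u where u: "u \<in> X" "N u = 1" "N (\<lambda>k. Dop u k - 1 * u k) \<le> e / 4 ^ n"
    unfolding two_pow_inv_def by (auto elim: approx_eigenvectorE)
  have "\<bar>N (tens (ones (2 ^ n)) u) - 1 ^ n\<bar> \<le> 4 ^ n * (e / 4 ^ n)"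
    by (rule N_copies_close[OF u(1,2) _ _ u(3)]) auto
  then have up: "N (tens (ones (2 ^ n)) u) \<le> 1 + e" by simp
  have "lp_copies \<infinity> n u (1 - e) (1 + e)"
  proof (rule lp_copies_normalizedI[OF _ _ u(1)])
    fix b :: "nat \<Rightarrow> real" assume b: "\<And>l. 0 \<le> b l" "\<And>l. n \<le> l \<Longrightarrow> b l = 0" "pnorm \<infinity> n b = 1"
    have fb: "finite {k. b k \<noteq> 0}"
      by (rule finite_subset[of _ "{..<n}"]) (use b(2) not_le in auto)
    have "Max ((\<lambda>k. \<bar>b k\<bar>) ` {..<n}) \<in> (\<lambda>k. \<bar>b k\<bar>) ` {..<n}"
      using n by (intro Max_in) (auto simp: lessThan_empty_iff)
    then obtain k where k: "k < n" "\<bar>b k\<bar> = 1" using b(3) by (auto simp: pnorm_def)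
    have "N u \<le> N (tens b u)"
      by (rule rearrange_dominated(2)[OF tens_mem[OF fb u(1)], of "\<lambda>i. prod_encode (k, i)"])
         (auto simp: tens_def abs_mult k intro: inj_onI)
    moreover have "N (tens b u) \<le> N (tens (ones n) u)"
    proof (rule N_tens_mono[OF finite_ones u(1), of id])
      fix k assume "b k \<noteq> 0"
      then have "k < n" using b(2) not_le by blast
      then show "\<bar>b k\<bar> \<le> \<bar>ones n (id k)\<bar>" using pnorm_ge_coord[of \<infinity> k n b] b(3) by simp
    qed simp
    moreover have "N (tens (ones n) u) \<le> N (tens (ones (2 ^ n)) u)"
      by (rule N_tens_ones_mono[OF u(1)]) (simp add: less_imp_le)
    ultimately show "1 - e \<le> N (tens b u) \<and> N (tens b u) \<le> 1 + e" using up u(2) e by linarith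
  qed (use n in auto)
  then show ?thesis using u(1) by blast
qed

text \<open>Scaled by \<open>2 ^ L\<close>, the p-th powers of the coefficients are rounded to
  powers of two, which compares \<open>b k\<close> with \<open>l ^ c k / l ^ L\<close>. By
  \<open>N_weighted_copies_close\<close> the norm becomes that of a number of copies comparable to
  \<open>2 ^ L\<close>, which is about \<open>l ^ L\<close>. The constant 8 absorbs the
  rounding.\<close>

lemma approx_eigenvalue_imp_lp_copies_finite:
  assumes p: "p \<noteq> \<infinity>" "1 \<le> p" and eig: "approx_eigenvalue Dop (two_pow_inv p) X N" and n: "1 \<le> n"
  shows "\<exists>x\<in>X. lp_copies p n x (1 / 8) 8"
proof -
  define P where "P = real_of_ereal p"
  have P: "1 \<le> P" using p(2) by (rule ereal_ge_1_cases) (use p(1) in \<open>auto simp: P_def\<close>)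
  define l where "l = (2::real) powr (1 / P)"
  have l1: "1 \<le> l" unfolding l_def using P by (intro ge_one_powr_ge_zero) auto
  have "l \<le> 2 powr 1" unfolding l_def using P by (intro powr_mono) auto
  then have l2: "l \<le> 2" by simp
  have l0: "0 \<le> l" using l1 by simp
  have lpow: "l ^ k = (2 ^ k) powr (1 / P)" for k
    by (simp add: l_def powr_realpow[symmetric] powr_powr powr_powr_swap mult.commute)
  have tp: "two_pow_inv p = l" using p by (simp add: two_pow_inv_def l_def P_def)
  \<comment> \<open>Large enough that rounding \<open>n\<close> numbers, each by less than 1, loses
    at most half of the total \<open>2 ^ L\<close>.\<close>
  define L where "L = n + 2"
  \<comment> \<open>One estimate for unweighted and one for \<open>n\<close> weighted copies cost
    \<open>(n + 1) * \<eta> = 1 / 8\<close> together. The exponent \<open>L + 2\<close> in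
    \<open>\<delta>\<close> covers the largest number of copies considered,
    \<open>2 ^ (L + 2)\<close>.\<close>
  define \<eta> where "\<eta> = 1 / (8 * (real n + 1))"
  define \<delta> where "\<delta> = \<eta> / 4 ^ (L + 2)"
  have \<eta>: "0 < \<eta>" "(real n + 1) * \<eta> = 1 / 8" by (auto simp: \<eta>_def field_simps)
  have \<delta>: "0 < \<delta>" "4 ^ (L + 2) * \<delta> = \<eta>" using \<eta> by (auto simp: \<delta>_def)
  obtain u where u: "u \<in> X" "N u = 1" and close: "N (\<lambda>k. Dop u k - l * u k) \<le> \<delta>"
    by (rule approx_eigenvectorE[OF eig[unfolded tp] \<delta>(1)])
  have single: "\<bar>N (tens (ones (2 ^ m)) u) - l ^ m\<bar> \<le> \<eta>" if "m \<le> L + 2" for m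
  proof -
    have "4 ^ m * \<delta> \<le> 4 ^ (L + 2) * \<delta>" using that \<delta>(1) by (intro mult_right_mono power_increasing) auto
    then show ?thesis using N_copies_close[OF u l0 l2 close, of m] \<delta>(2) by linarith
  qed
  have weighted: "\<bar>N (tens (\<lambda>k. if k \<in> A then l ^ c k else 0) u) - N (tens (ones (\<Sum>k\<in>A. 2 ^ c k)) u)\<bar> \<le> n * \<eta>"
    if "A \<subseteq> {..<n}" "\<And>k. k \<in> A \<Longrightarrow> c k \<le> L + 2" for A c
  proof -
    have A: "finite A" "card A \<le> n" using that(1) finite_subset card_mono[of "{..<n}" A] by auto
    have "real (card A) * \<eta> \<le> n * \<eta>" using A \<eta> by (intro mult_right_mono) auto
    moreover have "\<bar>N (tens (\<lambda>k. if k \<in> A then l ^ c k else 0) u) - N (tens (ones (\<Sum>k\<in>A. 2 ^ c k)) u)\<bar>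
        \<le> real (card A) * (4 ^ (L + 2) * \<delta>)"
      by (rule N_weighted_copies_close[OF A(1) u l0 l2 close], erule that(2))
    ultimately show ?thesis unfolding \<delta>(2) by linarith
  qed
  have nL: "real n \<le> 2 ^ L / 2"
  proof -
    have "real n \<le> 2 ^ n" "(0::real) \<le> 2 ^ n" by (simp_all add: less_imp_le)
    moreover have "(2::real) ^ L / 2 = 2 * 2 ^ n" by (simp add: L_def)
    ultimately show ?thesis by linarith
  qed
  have "lp_copies p n u (1 / 8) 8"
  proof (rule lp_copies_normalizedI[OF p(2) _ u(1)])
    fix b :: "nat \<Rightarrow> real" assume b: "\<And>l. 0 \<le> b l" "\<And>l. n \<le> l \<Longrightarrow> b l = 0" "pnorm p n b = 1"
    have fb: "finite {k. b k \<noteq> 0}"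
      by (rule finite_subset[of _ "{..<n}"]) (use b(2) not_le in auto)
    have sb: "(\<Sum>k<n. b k powr P) = 1"
      using pnorm_powr[OF p(1), of n b] P b by (simp add: P_def)
    define r where "r k = nat \<lfloor>2 ^ L * b k powr P\<rfloor>" for k
    \<comment> \<open>For \<open>r k = 0\<close> this is 0, so \<open>2 ^ c k\<close> exceeds
      \<open>r k\<close>. The summand 1 in \<open>c3\<close> and the restriction to
      \<open>?A\<close> account for that.\<close>
    define c where "c k = floor_log (r k)" for k
    have r: "real (r k) \<le> 2 ^ L * b k powr P" "2 ^ L * b k powr P < real (r k) + 1" for k
      by (auto simp: r_def)
    have c1: "real (r k) + 1 \<le> 2 ^ Suc (c k)" for k
    proof -
      have "r k + 1 \<le> 2 ^ Suc (c k)" using floor_log_exp2_gt[of "r k"] by (simp add: c_def)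
      then have "real (r k + 1) \<le> real (2 ^ Suc (c k))" by (rule of_nat_mono)
      then show ?thesis by simp
    qed
    have c2: "2 ^ c k \<le> real (r k)" if "0 < r k" for k
      using of_nat_mono[OF floor_log_exp2_le[OF that], where 'a = real] by (simp add: c_def)
    have c3: "2 ^ c k \<le> real (r k) + 1" for k
    proof (cases "r k = 0")
      case False
      then show ?thesis using c2[of k] by linarith
    qed (simp add: c_def)
    have cL: "c k \<le> L" if "k < n" for k
    proof -
      have "b k powr P \<le> 1" using member_le_sum[of k "{..<n}" "\<lambda>k. b k powr P"] that sb by simp
      then have "2 ^ L * b k powr P \<le> 2 ^ L * 1" by (intro mult_left_mono) auto
      then have "real (r k) \<le> 2 ^ L" using r(1)[of k] by linarith
      then have "real (r k) \<le> real (2 ^ L)" by simp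
      then have "r k \<le> 2 ^ L" unfolding of_nat_le_iff .
      then show ?thesis using floor_log_le_iff[of "r k" "2 ^ L"] by (simp add: c_def)
    qed
    have bk: "b k = (b k powr P) powr (1 / P)" for k using b(1)[of k] P by (simp add: powr_powr)
    have div: "l ^ i / l ^ L = (2 ^ i / 2 ^ L) powr (1 / P)" for i
      by (simp add: lpow powr_divide)
    have up: "b k \<le> l ^ Suc (c k) / l ^ L" for k
    proof -
      have "b k powr P \<le> 2 ^ Suc (c k) / 2 ^ L" using r(2)[of k] c1[of k] by (simp add: field_simps)
      then show ?thesis unfolding div using P by (subst bk) (intro powr_mono2, auto)
    qed
    have low: "l ^ c k / l ^ L \<le> b k" if "0 < r k" for k
    proof -
      have "2 ^ c k / 2 ^ L \<le> b k powr P" using order_trans[OF c2[OF that] r(1)] by (simp add: field_simps)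
      then show ?thesis unfolding div using P by (subst bk) (intro powr_mono2, auto)
    qed
    have lL: "1 \<le> l ^ L" using l1 by simp
    have scaled: "N (tens (\<lambda>k. 1 / l ^ L * f k) u) = N (tens f u) / l ^ L" if "finite {k. f k \<noteq> 0}" for f
      unfolding tens_scale_left using N_scale[OF tens_mem[OF that u(1)], of "1 / l ^ L"] lL by simp
    have fin: "finite {k. (if k \<in> A then g k else 0) \<noteq> (0::real)}" if "A \<subseteq> {..<n}" for A g
      by (rule finite_subset[of _ "{..<n}"]) (use that in auto)
    have "N (tens b u) \<le> 8"
    proof -
      \<comment> \<open>Raising the exponent by 1 puts the scaled weights above all coefficients,
        also those with \<open>r k = 0\<close>; at most \<open>2 ^ (L + 2)\<close> copies
        result.\<close>
      let ?f = "\<lambda>k. if k \<in> {..<n} then l ^ Suc (c k) else 0"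
      have ff: "finite {k. ?f k \<noteq> 0}" by (rule fin) simp
      have ff': "finite {k. 1 / l ^ L * ?f k \<noteq> 0}" by (rule finite_subset[OF _ ff]) auto
      have "(\<Sum>k<n. 2 ^ Suc (c k)) \<le> (\<Sum>k<n. 2 * (2 ^ L * b k powr P + 1))"
      proof (rule sum_mono)
        fix k
        show "2 ^ Suc (c k) \<le> 2 * (2 ^ L * b k powr P + 1)"
          unfolding power_Suc
          by (rule mult_left_mono[OF order_trans[OF c3 add_right_mono[OF r(1)]]]) simp
      qed
      also have "\<dots> = 2 * (2 ^ L + real n)"
        using sb by (simp add: sum.distrib sum_distrib_left[symmetric])
      also have "\<dots> \<le> 4 * 2 ^ L"
      proof -
        have "(0::real) \<le> 2 ^ L" by simp
        then show ?thesis using nL by (simp only: distrib_left)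
      qed
      also have "(4::real) * 2 ^ L = 2 ^ (L + 2)" by (simp add: power_add)
      finally have "real (\<Sum>k<n. 2 ^ Suc (c k)) \<le> real (2 ^ (L + 2))" by simp
      then have cnt: "(\<Sum>k<n. 2 ^ Suc (c k)) \<le> (2::nat) ^ (L + 2)" unfolding of_nat_le_iff .
      have "N (tens ?f u) \<le> N (tens (ones (\<Sum>k<n. 2 ^ Suc (c k))) u) + n * \<eta>"
        using weighted[of "{..<n}" "\<lambda>k. Suc (c k)"] cL by fastforce
      moreover have "N (tens (ones (\<Sum>k<n. 2 ^ Suc (c k))) u) \<le> N (tens (ones (2 ^ (L + 2))) u)"
        by (rule N_tens_ones_mono[OF u(1) cnt])
      moreover have "N (tens (ones (2 ^ (L + 2))) u) \<le> l ^ (L + 2) + \<eta>" using single[of "L + 2"] by simp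
      moreover have "\<eta> + n * \<eta> = 1 / 8" using \<eta>(2) by (simp add: distrib_right)
      moreover have "l ^ (L + 2) \<le> l ^ L * 4"
        unfolding power_add using power_mono[OF l2 l0, of 2] l0 by (intro mult_left_mono) auto
      ultimately have F: "N (tens ?f u) \<le> l ^ L * 4 + 1 / 8" by linarith
      have "N (tens b u) \<le> N (tens (\<lambda>k. 1 / l ^ L * ?f k) u)"
      proof (rule N_tens_mono[OF ff' u(1), of id])
        fix k assume "b k \<noteq> 0"
        then have "k < n" using b(2) not_le by blast
        then show "\<bar>b k\<bar> \<le> \<bar>1 / l ^ L * ?f (id k)\<bar>" using up[of k] b(1)[of k] l0 by simp
      qed simp
      also have "\<dots> = N (tens ?f u) / l ^ L" by (rule scaled[OF ff])
      also have "\<dots> \<le> 8" using F lL by (simp add: pos_divide_le_eq)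
      finally show ?thesis .
    qed
    moreover have "1 / 8 \<le> N (tens b u)"
    proof -
      \<comment> \<open>Discarding the coefficients with \<open>r k = 0\<close> costs at most
        \<open>n\<close> in total, so at least \<open>2 ^ L / 4 = 2 ^ n\<close> copies
        remain.\<close>
      let ?A = "{k \<in> {..<n}. 0 < r k}"
      let ?f = "\<lambda>k. if k \<in> ?A then l ^ c k else 0"
      have ff: "finite {k. ?f k \<noteq> 0}" by (rule fin) auto
      have "2 ^ L = (\<Sum>k<n. 2 ^ L * b k powr P)" using sb by (simp add: sum_distrib_left[symmetric])
      also have "\<dots> \<le> (\<Sum>k<n. 1 + (if k \<in> ?A then 2 * 2 ^ c k else 0))"
      proof (rule sum_mono)
        fix k assume "k \<in> {..<n}"
        then show "2 ^ L * b k powr P \<le> 1 + (if k \<in> ?A then 2 * 2 ^ c k else 0)"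
          using r(2)[of k] c1[of k] by auto
      qed
      also have "\<dots> = real n + (\<Sum>k<n. if k \<in> ?A then 2 * 2 ^ c k else 0)"
        by (simp only: sum.distrib) simp
      also have "(\<Sum>k<n. if k \<in> ?A then 2 * 2 ^ c k else 0) = (\<Sum>k\<in>?A. 2 * 2 ^ c k :: real)"
        by (rule sum.mono_neutral_cong_right) auto
      finally have "2 ^ L / 4 \<le> (\<Sum>k\<in>?A. 2 ^ c k :: real)"
        using nL by (simp add: sum_distrib_left[symmetric])
      moreover have "(2::real) ^ L / 4 = 2 ^ n" by (simp add: L_def)
      ultimately have "real (2 ^ n) \<le> real (\<Sum>k\<in>?A. 2 ^ c k)" by simp
      then have cnt: "(2::nat) ^ n \<le> (\<Sum>k\<in>?A. 2 ^ c k)" unfolding of_nat_le_iff .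
      have "l ^ n - \<eta> \<le> N (tens (ones (2 ^ n)) u)" using single[of n] by (simp add: L_def)
      also have "\<dots> \<le> N (tens (ones (\<Sum>k\<in>?A. 2 ^ c k)) u)" by (rule N_tens_ones_mono[OF u(1) cnt])
      also have "\<dots> \<le> N (tens ?f u) + n * \<eta>"
        using weighted[of ?A c] cL by fastforce
      finally have "l ^ n - 1 / 8 \<le> N (tens ?f u)" using \<eta>(2) by (simp add: distrib_right)
      then have "(l ^ n - 1 / 8) / l ^ L \<le> N (tens ?f u) / l ^ L" using lL by (intro divide_right_mono) auto
      also have "\<dots> = N (tens (\<lambda>k. 1 / l ^ L * ?f k) u)" by (rule scaled[OF ff, symmetric])
      also have "\<dots> \<le> N (tens b u)"
      proof (rule N_tens_mono[OF fb u(1), of id])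
        fix k assume "1 / l ^ L * ?f k \<noteq> 0"
        then have "0 < r k" "k < n" by (auto split: if_splits)
        then show "\<bar>1 / l ^ L * ?f k\<bar> \<le> \<bar>b (id k)\<bar>" using low[of k] b(1)[of k] l0 by simp
      qed simp
      finally have "(l ^ n - 1 / 8) / l ^ L \<le> N (tens b u)" .
      moreover have "1 / 8 \<le> (l ^ n - 1 / 8) / l ^ L"
      proof -
        have "l\<^sup>2 \<le> 4" using power_mono[OF l2 l0, of 2] by simp
        then have "l ^ n * l\<^sup>2 \<le> l ^ n * 4" using l0 by (intro mult_left_mono) auto
        then have "l ^ L \<le> l ^ n * 4" unfolding L_def power_add .
        moreover have "1 \<le> l ^ n" using l1 by simp
        ultimately show ?thesis using lL by (simp add: pos_le_divide_eq)
      qed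
      ultimately show ?thesis by linarith
    qed
    ultimately show "1 / 8 \<le> N (tens b u) \<and> N (tens b u) \<le> 8" by blast
  qed (use n in simp)
  then show ?thesis using u(1) by blast
qed

end

theorem theorem3p1:
  fixes X :: "(nat \<Rightarrow> real) set" and N :: "(nat \<Rightarrow> real) \<Rightarrow> real" and p :: ereal
  assumes "symmetric_seq_space X N" and "separable_seq_space X N" and "1 \<le> p"
  shows "(sym_block_fin_rep p X N \<longleftrightarrow> sym_fin_rep p X N)
       \<and> (sym_fin_rep p X N \<longleftrightarrow> crude_sym_fin_rep p X N)
       \<and> (crude_sym_fin_rep p X N \<longleftrightarrow> approx_eigenvalue Dop (two_pow_inv p) X N)"
proof -
  interpret symm_space X N by unfold_locales (rule assms(1))
  note sep = assms(2) and p = assms(3)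
  have ab: "sym_block_fin_rep p X N \<Longrightarrow> sym_fin_rep p X N" by (rule sym_block_imp_sym)
  have bc: "sym_fin_rep p X N \<Longrightarrow> crude_sym_fin_rep p X N" by (rule sym_imp_crude)
  have cd: "approx_eigenvalue Dop (two_pow_inv p) X N" if "crude_sym_fin_rep p X N"
    using crude_imp_lp_copies[OF that] lp_copies_imp_approx_eigenvalue[OF p] by metis
  show ?thesis
  proof (cases "p = \<infinity>")
    case True
    \<comment> \<open>For \<open>p = \<infinity>\<close> eigenvectors yield constants close to 1 at
      once, so (d) leads directly to (a).\<close>
    have "sym_block_fin_rep p X N" if "approx_eigenvalue Dop (two_pow_inv p) X N"
      by (rule lp_copies_imp_sym_block[OF sep p], unfold True)
         (rule approx_eigenvalue_imp_lp_copies_infinite[OF that[unfolded True]])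
    then show ?thesis using ab bc cd by blast
  next
    case False
    have ca: "sym_block_fin_rep p X N" if crude: "crude_sym_fin_rep p X N"
    proof -
      obtain C where C: "0 < C" "\<And>n. 1 \<le> n \<Longrightarrow> \<exists>x\<in>X. lp_copies p n x (1 / C) C"
        by (rule crude_imp_lp_copies[OF crude], rule that, assumption, blast)
      show ?thesis
        by (rule lp_copies_imp_sym_block[OF sep p], rule lp_copies_improve[OF False p C(1)])
           (erule C(2))
    qed
    \<comment> \<open>For finite \<open>p\<close> eigenvectors yield the constant 8, so (a) is
      reached from (d) through (c).\<close>
    have dc: "crude_sym_fin_rep p X N" if "approx_eigenvalue Dop (two_pow_inv p) X N"
      by (rule lp_copies_imp_crude[OF sep p, of 8])
         (simp, rule approx_eigenvalue_imp_lp_copies_finite[OF False p that])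
    show ?thesis using ab bc cd ca dc by blast
  qed
qed

end
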